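(* Let $\beta,\omega>1$ and $\varepsilon^*>0$ be constants, let $C_3>0$ be a fixed constant and $(\nu_n)$ a fixed sequence of positive numbers with $\nu_n\to0$, and let $m,K,L,I^*$ depend on $n$. Let $\alpha=m/n$, and let $\mathcal S=\mathcal S(n,m,K,L,I^* )$ be the set of all triples $(y,z,P)$ with $y\in[K]^n$, $z\in[L]^m$, $P\in[0,1]^{K\times L}$ such that, with $\Lambda=(\lambda_{k\ell})$, $\lambda_{k\ell}=P_{k\ell}n_\ell(z)$: (i) $I_{\min}(\Lambda)\ge I^*$ and $\varepsilon\ge\varepsilon^*$; (ii) $\|\Lambda\|_\infty/\Lambda_{\min}\le\omega$; (iii) $\frac1{\beta K}\le\pi_k(y)\le\frac\beta K$ and $\frac1{\beta L}\le\pi_\ell(z)\le\frac\beta L$ for all $k\in[K],\ell\in[L]$; (iv) $(Q^2\log Q)\beta^2\omega^3KL(K\vee L)\log(K\vee L)\,\|\Lambda\|_\infty^2\le C_3\,(n\wedge m)$; (v) $(Q\log Q)^2\beta^3\omega^2(K\vee L)^3(\alpha\vee\alpha^{-1})\|\Lambda\|_\infty\le\nu_n\,I_{\min}(\Lambda)^2$. Assume that there exists $(y,z,P)\in\mathcal S$ with $I_{\min}(\Lambda)=I^*$, and that $K\le\exp(cL)$ for some constant $c>0$. Then there is a constant $C$ such that, for large $n$, $$\inf_{\hat y}\ \sup_{(y,z,P)\in\mathcal S}E[\mathrm{Mis}(\hat y,y)]\ \ge\ \exp\big(-I^*-L(\log I^*+C)\big),$$ where the infimum is over all estimators $\hat y$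 of the row labels (functions of $A$ with values in $[K]^n$) and the expectation is under $A\sim\mathrm{SBM}(y,z,P)$.
   Context: $[N]=\{1,\dots,N\}$, $a\vee b=\max$, $a\wedge b=\min$. $A\sim\mathrm{SBM}(y,z,P)$ means that the entries $A_{ij}\in\{0,1\}$ of $A\in\{0,1\}^{n\times m}$ are independent Bernoulli with $E[A_{ij}]=P_{y_iz_j}$. $n_k(y)=|\{i:y_i=k\}|$, $\pi_k(y)=n_k(y)/n$, $n_\ell(z)=|\{j:z_j=\ell\}|$, $\pi_\ell(z)=n_\ell(z)/m$. $\Lambda_{\min}$ and $\|\Lambda\|_\infty$ are the minimum and maximum entries of $\Lambda$. For $k,r\in[K]$, $$I_{kr}(\Lambda)=\sup_{s\in(0,1)}\sum_{\ell=1}^L\big[(1-s)\lambda_{k\ell}+s\lambda_{r\ell}-\lambda_{k\ell}^{1-s}\lambda_{r\ell}^s\big],\quad I_{\min}(\Lambda)=\min_{k\ne r}I_{kr}(\Lambda),$$ $\varepsilon_{kr}=\max_{\ell\in[L]}\big(\frac{\lambda_{k\ell}}{\lambda_{r\ell}}\vee\frac{\lambda_{r\ell}}{\lambda_{k\ell}}\big)-1$ and $\varepsilon=\min_{k\ne r}\varepsilon_{kr}$. $Q\in\mathbb N$ is a fixed constant (the number of sub-blocks per side used by the paper's algorithm, $Q=4$). $\mathrm{Mis}(\hat y,y)=\min_\sigma\frac1n\sum_{i=1}^n1\{\sigma(\hat y_i)\ne y_i\}$, the minimum over permutations $\sigma$ of $[K]$. *)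

theory Defs
  imports "HOL-Probability.Probability" "HOL-Combinatorics.Permutations"
begin

text \<open>
  The index set \<open>[N]\<close> is \<open>{1..N}\<close>. Label vectors and connectivity matrices are
  extensional functions on their index sets (value \<^const>\<open>undefined\<close> elsewhere), so that
  \<open>{1..n} \<rightarrow>\<^sub>E {1..K}\<close> is exactly \<open>[K]\<^sup>n\<close>.
\<close>

definition label_count :: "nat \<Rightarrow> (nat \<Rightarrow> nat) \<Rightarrow> nat \<Rightarrow> nat" where
  "label_count N y k = card {i \<in> {1..N}. y i = k}"

definition label_prop :: "nat \<Rightarrow> (nat \<Rightarrow> nat) \<Rightarrow> nat \<Rightarrow> real" where
  "label_prop N y k = real (label_count N y k) / real N"

definition rates :: "nat \<Rightarrow> (nat \<Rightarrow> nat) \<Rightarrow> (nat \<times> nat \<Rightarrow> real) \<Rightarrow> nat \<Rightarrow> nat \<Rightarrow> real" where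
  "rates m z P k l = P (k, l) * real (label_count m z l)"

definition rate_max :: "nat \<Rightarrow> nat \<Rightarrow> (nat \<Rightarrow> nat \<Rightarrow> real) \<Rightarrow> real" where
  "rate_max K L \<Lambda> = Max ((\<lambda>(k, l). \<Lambda> k l) ` ({1..K} \<times> {1..L}))"

definition rate_min :: "nat \<Rightarrow> nat \<Rightarrow> (nat \<Rightarrow> nat \<Rightarrow> real) \<Rightarrow> real" where
  "rate_min K L \<Lambda> = Min ((\<lambda>(k, l). \<Lambda> k l) ` ({1..K} \<times> {1..L}))"

definition info :: "nat \<Rightarrow> (nat \<Rightarrow> nat \<Rightarrow> real) \<Rightarrow> nat \<Rightarrow> nat \<Rightarrow> real" where
  "info L \<Lambda> k r =
     (SUP s\<in>{0<..<1}. \<Sum>l=1..L.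
        (1 - s) * \<Lambda> k l + s * \<Lambda> r l - \<Lambda> k l powr (1 - s) * \<Lambda> r l powr s)"

text \<open>The minima over \<open>k \<noteq> r\<close> below are meaningful only for \<open>K \<ge> 2\<close>.\<close>

definition info_min :: "nat \<Rightarrow> nat \<Rightarrow> (nat \<Rightarrow> nat \<Rightarrow> real) \<Rightarrow> real" where
  "info_min K L \<Lambda> = Min {info L \<Lambda> k r |k r. k \<in> {1..K} \<and> r \<in> {1..K} \<and> k \<noteq> r}"

definition eps_pair :: "nat \<Rightarrow> (nat \<Rightarrow> nat \<Rightarrow> real) \<Rightarrow> nat \<Rightarrow> nat \<Rightarrow> real" where
  "eps_pair L \<Lambda> k r = Max ((\<lambda>l. max (\<Lambda> k l / \<Lambda> r l) (\<Lambda> r l / \<Lambda> k l)) ` {1..L}) - 1"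

definition eps_min :: "nat \<Rightarrow> nat \<Rightarrow> (nat \<Rightarrow> nat \<Rightarrow> real) \<Rightarrow> real" where
  "eps_min K L \<Lambda> = Min {eps_pair L \<Lambda> k r |k r. k \<in> {1..K} \<and> r \<in> {1..K} \<and> k \<noteq> r}"

text \<open>
  A random 0/1 matrix is a Boolean function of the index pair (\<^const>\<open>True\<close> standing for 1),
  equal to \<^const>\<open>False\<close> outside the index set \<open>[n] \<times> [m]\<close>.
\<close>

definition SBM ::
  "nat \<Rightarrow> nat \<Rightarrow> (nat \<Rightarrow> nat) \<Rightarrow> (nat \<Rightarrow> nat) \<Rightarrow> (nat \<times> nat \<Rightarrow> real) \<Rightarrow> (nat \<times> nat \<Rightarrow> bool) pmf" where
  "SBM n m y z P = Pi_pmf ({1..n} \<times> {1..m}) False (\<lambda>(i, j). bernoulli_pmf (P (y i, z j)))"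

definition Mis :: "nat \<Rightarrow> nat \<Rightarrow> (nat \<Rightarrow> nat) \<Rightarrow> (nat \<Rightarrow> nat) \<Rightarrow> real" where
  "Mis n K yhat y =
     Min ((\<lambda>\<sigma>. (\<Sum>i=1..n. of_bool (\<sigma> (yhat i) \<noteq> y i)) / real n) ` {\<sigma>. \<sigma> permutes {1..K}})"

text \<open>
  The law \<open>SBM n m y z P\<close> has finite support, so no measurability has to be required of an
  estimator, and its values at arguments that are not \<open>n \<times> m\<close> matrices are irrelevant.
\<close>

definition estimators :: "nat \<Rightarrow> nat \<Rightarrow> ((nat \<times> nat \<Rightarrow> bool) \<Rightarrow> nat \<Rightarrow> nat) set" where
  "estimators n K = UNIV \<rightarrow> ({1..n} \<rightarrow>\<^sub>E {1..K})"

text \<open>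
  The condition \<open>rate_min K L \<Lambda> > 0\<close> is what finiteness of the ratio
  \<open>rate_max K L \<Lambda> / rate_min K L \<Lambda>\<close> (and of the ratios in \<^const>\<open>eps_pair\<close>) amounts to;
  it is explicit because division by zero yields zero. The argument \<open>\<nu>\<close> is the
  value \<open>\<nu>\<^sub>n\<close>.
\<close>

definition sbm_class ::
  "nat \<Rightarrow> real \<Rightarrow> real \<Rightarrow> real \<Rightarrow> real \<Rightarrow> real \<Rightarrow> nat \<Rightarrow> nat \<Rightarrow> nat \<Rightarrow> nat \<Rightarrow> real \<Rightarrow>
     ((nat \<Rightarrow> nat) \<times> (nat \<Rightarrow> nat) \<times> (nat \<times> nat \<Rightarrow> real)) set" where
  "sbm_class Q \<beta> \<omega> \<epsilon>star C3 \<nu> n m K L Istar =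
     {(y, z, P).
        y \<in> {1..n} \<rightarrow>\<^sub>E {1..K} \<and> z \<in> {1..m} \<rightarrow>\<^sub>E {1..L} \<and>
        P \<in> ({1..K} \<times> {1..L}) \<rightarrow>\<^sub>E {0..1} \<and>
        (let \<Lambda> = rates m z P; \<alpha> = real m / real n; KL = real (max K L) in
          info_min K L \<Lambda> \<ge> Istar \<and> eps_min K L \<Lambda> \<ge> \<epsilon>star \<and>
          rate_min K L \<Lambda> > 0 \<and> rate_max K L \<Lambda> / rate_min K L \<Lambda> \<le> \<omega> \<and>
          (\<forall>k\<in>{1..K}. 1 / (\<beta> * real K) \<le> label_prop n y k \<and> label_prop n y k \<le> \<beta> / real K) \<and>
          (\<forall>l\<in>{1..L}. 1 / (\<beta> * real L) \<le> label_prop m z l \<and> label_prop m z l \<le> \<beta> / real L) \<and>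
          ((real Q)\<^sup>2 * ln (real Q)) * \<beta>\<^sup>2 * \<omega> ^ 3 * real K * real L * KL * ln KL
              * (rate_max K L \<Lambda>)\<^sup>2 \<le> C3 * real (min n m) \<and>
          (real Q * ln (real Q))\<^sup>2 * \<beta> ^ 3 * \<omega>\<^sup>2 * KL ^ 3 * max \<alpha> (inverse \<alpha>)
              * rate_max K L \<Lambda> \<le> \<nu> * (info_min K L \<Lambda>)\<^sup>2)}"

end

theory Submission
  imports Defs
begin

text \<open>
  Membership in the class restricts the row labels only through their proportions, so for fixed
  \<open>z\<close> and \<open>P\<close> every sufficiently balanced labelling belongs to it. Take \<open>z\<close> and \<open>P\<close> from an
  instance whose information equals \<open>I\<close>, attained at clusters \<open>k \<noteq> r\<close>. Start from the labelling
  \<open>1, \<dots>, K, 1, \<dots>, K, \<dots>\<close> and let a set \<open>T\<close> of about \<open>\<delta> n / K\<close> rows of cluster \<open>k\<close> choose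
  freely between \<open>k\<close> and \<open>r\<close>; the slack \<open>\<beta> > 1\<close> keeps all these \<open>2^|T|\<close> labellings balanced.
  Because every cluster keeps at least \<open>|T|\<close> fixed rows, relabelling clusters cannot bring
  two of these labellings closer together (\<open>Mis_separation\<close>), and Assouad's lemma (\<open>Assouad\<close>) bounds the
  worst risk below by \<open>|T| / (4 n)\<close>, which is of order \<open>1 / K \<ge> exp (- c L)\<close>, times the error of
  testing \<open>k\<close> against \<open>r\<close> from one single row.

  That testing error is at least the total smaller likelihood of any family of rows. The family
  used consists of all rows that have exactly \<open>X l\<close> ones in column block \<open>l\<close>, where \<open>X l\<close> is the
  integer part of \<open>a\<^sup>1\<^sup>-\<^sup>s b\<^sup>s\<close> with \<open>a = \<Lambda> k l\<close>, \<open>b = \<Lambda> r l\<close>, and \<open>s\<close> is a stationary point of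
  the function whose supremum is \<open>I\<close>. Stationarity makes the Poisson log likelihoods of \<open>k\<close> and
  \<open>r\<close> coincide at the unrounded point, where both equal \<open>- I\<close> up to Stirling factors
  (\<open>block_binomials_at_chernoff_point\<close>). Rounding costs a constant per block because all ratios
  are at most \<open>\<omega>\<close>; replacing binomial by Poisson weights costs a constant per block because the
  size condition bounds the squared rates by a multiple of the block sizes. Even the crude bound
  \<open>X! \<le> e X (X/e)\<^sup>X\<close> suffices: it loses a factor \<open>1 / M\<close> per block, \<open>M\<close> being the largest rate, and
  \<open>M\<close> is at most a constant times \<open>I\<close> because any two clusters have a block with rate ratio
  at least \<open>1 + \<epsilon>\<close> (\<open>Istar_ge\<close>).

  The limit \<open>\<nu> \<rightarrow> 0\<close> matters because it forces \<open>M\<close> to infinity: \<open>I \<le> L M\<close> turns the signal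
  condition into \<open>M \<ge> 1 / \<nu>\<close> (\<open>M_large\<close>), and then \<open>n / K \<ge> M\<^sup>2 / C3\<close> (\<open>size_bounds\<close>) gives room
  for \<open>T\<close>.
\<close>

section \<open>Testing two laws\<close>

text \<open>
  At each outcome, the test errs under one of the two laws, so the two error probabilities
  together collect at least the smaller of the two masses.
\<close>

lemma affinity_le_testing_errors:
  fixes p q :: "'a pmf"
  assumes "finite F"
  shows "(\<Sum>u\<in>F. min (pmf p u) (pmf q u))
           \<le> measure_pmf.prob p D + measure_pmf.prob q (- D)"
proof -
  have "(\<Sum>u\<in>F. min (pmf p u) (pmf q u))
      = (\<Sum>u\<in>F \<inter> D. min (pmf p u) (pmf q u)) + (\<Sum>u\<in>F - D. min (pmf p u) (pmf q u))"
    using assms by (rule sum.Int_Diff)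
  also have "\<dots> \<le> (\<Sum>u\<in>F \<inter> D. pmf p u) + (\<Sum>u\<in>F - D. pmf q u)"
    by (intro add_mono sum_mono) auto
  also have "\<dots> = measure_pmf.prob p (F \<inter> D) + measure_pmf.prob q (F - D)"
    using assms by (simp add: measure_measure_pmf_finite)
  also have "\<dots> \<le> measure_pmf.prob p D + measure_pmf.prob q (- D)"
    by (intro add_mono measure_pmf.finite_measure_mono) auto
  finally show ?thesis .
qed

text \<open>
  Two product laws that differ only on the coordinates in \<open>J\<close> are as hard to tell apart as their
  \<open>J\<close>-marginals: given the common remaining coordinates \<open>v\<close>, any test becomes a test between
  those marginals, and averaging over \<open>v\<close> preserves the bound.
\<close>

lemma affinity_le_testing_errors_Pi_pmf:
  fixes f g :: "'i \<Rightarrow> 'b pmf"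
  assumes "finite I" "J \<subseteq> I" and agree: "\<And>i. i \<in> I - J \<Longrightarrow> f i = g i" and "finite F"
  shows "(\<Sum>u\<in>F. min (pmf (Pi_pmf J d f) u) (pmf (Pi_pmf J d g) u))
           \<le> measure_pmf.prob (Pi_pmf I d f) D + measure_pmf.prob (Pi_pmf I d g) (- D)"
    (is "?a \<le> _")
proof -
  define h where "h = (\<lambda>v (u :: 'i \<Rightarrow> 'b) x. if x \<in> J then u x else v x)"
  define R where "R = Pi_pmf (I - J) d g"
  have fin: "finite J" "finite (I - J)"
    using assms by (auto intro: finite_subset)
  have I: "I = J \<union> (I - J)" using assms by auto
  have split: "Pi_pmf I d w = bind_pmf R (\<lambda>v. map_pmf (h v) (Pi_pmf J d w))"
    if "Pi_pmf (I - J) d w = R" for w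
  proof -
    have "Pi_pmf I d w = map_pmf (\<lambda>(u, v). h v u) (pair_pmf (Pi_pmf J d w) R)"
      using Pi_pmf_union[of J "I - J" d w] fin I that by (auto simp: h_def)
    also have "\<dots> = bind_pmf R (\<lambda>v. map_pmf (h v) (Pi_pmf J d w))"
      by (subst pair_commute_pmf) (simp add: pair_pmf_def map_pmf_def bind_assoc_pmf bind_return_pmf)
    finally show ?thesis .
  qed
  have Rf: "Pi_pmf (I - J) d f = R"
    unfolding R_def using agree fin by (intro Pi_pmf_cong) auto
  have "ennreal ?a = (\<integral>\<^sup>+v. ennreal ?a \<partial>R)"
    by (simp add: measure_pmf.emeasure_space_1)
  also have "\<dots> \<le> (\<integral>\<^sup>+v. emeasure (map_pmf (h v) (Pi_pmf J d f)) D
                        + emeasure (map_pmf (h v) (Pi_pmf J d g)) (- D) \<partial>R)"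
  proof (rule nn_integral_mono)
    fix v
    have "?a \<le> measure_pmf.prob (Pi_pmf J d f) (h v -` D)
             + measure_pmf.prob (Pi_pmf J d g) (- (h v -` D))"
      by (rule affinity_le_testing_errors) fact
    then show "ennreal ?a \<le> emeasure (map_pmf (h v) (Pi_pmf J d f)) D
                        + emeasure (map_pmf (h v) (Pi_pmf J d g)) (- D)"
      by (simp add: measure_pmf.emeasure_eq_measure vimage_Compl flip: ennreal_plus)
  qed
  also have "\<dots> = emeasure (Pi_pmf I d f) D + emeasure (Pi_pmf I d g) (- D)"
    unfolding split[OF Rf] split[OF R_def[symmetric]]
    by (subst nn_integral_add) auto
  finally show ?thesis
    by (simp add: measure_pmf.emeasure_eq_measure flip: ennreal_plus)
qed

section \<open>Assouad's lemma\<close>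

lemma card_sym_diff_eq_sum:
  assumes "finite T" "U \<subseteq> T" "V \<subseteq> T"
  shows "real (card {i \<in> T. (i \<in> U) \<noteq> (i \<in> V)}) = (\<Sum>i\<in>T. of_bool ((i \<in> U) \<noteq> (i \<in> V)))"
  using assms by (simp add: sum_of_bool_eq Int_def)

text \<open>Pairs each subset avoiding \<open>i\<close> with its neighbour in direction \<open>i\<close> of the Boolean cube.\<close>

lemma sum_Pow_split:
  fixes h :: "'a set \<Rightarrow> 'b :: comm_monoid_add"
  assumes "finite T" "i \<in> T"
  shows "(\<Sum>U\<in>Pow T. h U) = (\<Sum>U\<in>Pow (T - {i}). h U + h (insert i U))"
proof -
  have T: "T = insert i (T - {i})" using assms by auto
  have "(\<Sum>U\<in>Pow T. h U) = (\<Sum>U\<in>Pow (T - {i}) \<union> insert i ` Pow (T - {i}). h U)"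
    by (subst T, subst Pow_insert) simp
  also have "\<dots> = (\<Sum>U\<in>Pow (T - {i}). h U) + (\<Sum>U\<in>insert i ` Pow (T - {i}). h U)"
    using assms by (intro sum.union_disjoint) auto
  also have "(\<Sum>U\<in>insert i ` Pow (T - {i}). h U) = (\<Sum>U\<in>Pow (T - {i}). h (insert i U))"
    by (subst sum.reindex) (auto simp: inj_on_def)
  finally show ?thesis by (simp add: sum.distrib)
qed

text \<open>
  Round any decision \<open>A\<close> to the cube vertex \<open>V A\<close> of least loss. If \<open>U\<close> is the truth, then
  \<open>2 loss A U \<ge> loss A U + loss A (V A)\<close>, and separation bounds this below by the number of
  coordinates where \<open>V A\<close> errs. Averaged over all vertices, each coordinate \<open>i\<close> is a test between
  neighbouring vertices, whose two errors sum to at least \<open>B\<close>.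
\<close>

lemma Assouad:
  fixes M :: "'i set \<Rightarrow> 'a pmf" and loss :: "'a \<Rightarrow> 'i set \<Rightarrow> real"
  assumes "finite T" and fin: "\<And>U. U \<subseteq> T \<Longrightarrow> finite (set_pmf (M U))" and "c \<ge> 0"
    and sep: "\<And>A U V. U \<subseteq> T \<Longrightarrow> V \<subseteq> T \<Longrightarrow>
                c * real (card {i \<in> T. (i \<in> U) \<noteq> (i \<in> V)}) \<le> loss A U + loss A V"
    and test: "\<And>i U D. i \<in> T \<Longrightarrow> U \<subseteq> T - {i} \<Longrightarrow>
                B \<le> measure_pmf.prob (M U) D + measure_pmf.prob (M (insert i U)) (- D)"
  shows "\<exists>U\<subseteq>T. c * real (card T) * B / 4 \<le> measure_pmf.expectation (M U) (\<lambda>A. loss A U)"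
proof (rule ccontr)
  assume neg: "\<not> ?thesis"
  define V where "V = (\<lambda>A. arg_min_on (loss A) (Pow T))"
  have V: "V A \<subseteq> T" "U \<subseteq> T \<Longrightarrow> loss A (V A) \<le> loss A U" for A U
    using arg_min_if_finite(1)[of "Pow T" "loss A"] arg_min_least[of "Pow T" U "loss A"] \<open>finite T\<close>
    by (auto simp: V_def)
  let ?E = "\<lambda>U. measure_pmf.expectation (M U) (\<lambda>A. loss A U)"
  let ?P = "\<lambda>i U. measure_pmf.prob (M U) {A. (i \<in> U) \<noteq> (i \<in> V A)}"
  have E: "c / 2 * (\<Sum>i\<in>T. ?P i U) \<le> ?E U" if U: "U \<subseteq> T" for U
  proof -
    have prob: "?P i U = measure_pmf.expectation (M U) (\<lambda>A. of_bool ((i \<in> U) \<noteq> (i \<in> V A)))" for i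
    proof -
      have "?P i U = measure_pmf.expectation (M U) (indicator {A. (i \<in> U) \<noteq> (i \<in> V A)})"
        by simp
      also have "indicator {A. (i \<in> U) \<noteq> (i \<in> V A)}
          = (\<lambda>A. of_bool ((i \<in> U) \<noteq> (i \<in> V A)) :: real)"
        by (auto simp: indicator_def)
      finally show ?thesis .
    qed
    have "c / 2 * (\<Sum>i\<in>T. ?P i U)
        = c / 2 * (\<Sum>i\<in>T. measure_pmf.expectation (M U) (\<lambda>A. of_bool ((i \<in> U) \<noteq> (i \<in> V A))))"
      using prob by simp
    also have "\<dots> = measure_pmf.expectation (M U)
         (\<lambda>A. c / 2 * (\<Sum>i\<in>T. of_bool ((i \<in> U) \<noteq> (i \<in> V A))))"
      using fin[OF U]
      by (subst Bochner_Integration.integral_mult_right_zero, subst Bochner_Integration.integral_sum)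
         (auto intro: integrable_measure_pmf_finite)
    also have "\<dots> \<le> ?E U"
    proof (intro integral_mono integrable_measure_pmf_finite fin[OF U])
      fix A
      show "c / 2 * (\<Sum>i\<in>T. of_bool ((i \<in> U) \<noteq> (i \<in> V A))) \<le> loss A U"
        using sep[OF U V(1), of A A] V(2)[OF U, of A] card_sym_diff_eq_sum[OF \<open>finite T\<close> U V(1), of A]
        by simp
    qed
    finally show ?thesis .
  qed
  have flip: "2 ^ card T * B / 2 \<le> (\<Sum>U\<in>Pow T. ?P i U)" if i: "i \<in> T" for i
  proof -
    have "B \<le> ?P i U + ?P i (insert i U)" if U: "U \<in> Pow (T - {i})" for U
    proof -
      have "{A. (i \<in> U) \<noteq> (i \<in> V A)} = {A. i \<in> V A}"
        "{A. (i \<in> insert i U) \<noteq> (i \<in> V A)} = - {A. i \<in> V A}" using U by auto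
      then show ?thesis using test[OF i, of U "{A. i \<in> V A}"] U by simp
    qed
    then have "real (card (Pow (T - {i}))) * B \<le> (\<Sum>U\<in>Pow (T - {i}). ?P i U + ?P i (insert i U))"
      by (intro sum_bounded_below) auto
    moreover have "card T = Suc (card (T - {i}))"
      using i \<open>finite T\<close> by (metis card_Suc_Diff1)
    ultimately show ?thesis
      using sum_Pow_split[OF \<open>finite T\<close> i, of "?P i"] \<open>finite T\<close> by (simp add: card_Pow)
  qed
  have "2 ^ card T * (c * real (card T) * B / 4) = c / 2 * (\<Sum>i\<in>T. 2 ^ card T * B / 2)"
    by simp
  also have "\<dots> \<le> c / 2 * (\<Sum>i\<in>T. \<Sum>U\<in>Pow T. ?P i U)"
    using flip \<open>c \<ge> 0\<close> by (intro mult_left_mono sum_mono) auto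
  also have "\<dots> = (\<Sum>U\<in>Pow T. c / 2 * (\<Sum>i\<in>T. ?P i U))"
    by (subst sum.swap) (simp add: sum_distrib_left)
  also have "\<dots> \<le> (\<Sum>U\<in>Pow T. ?E U)"
    by (intro sum_mono E) auto
  also have "\<dots> < (\<Sum>U\<in>Pow T. c * real (card T) * B / 4)"
    using neg \<open>finite T\<close> by (intro sum_strict_mono) (auto simp: not_le)
  also have "\<dots> = 2 ^ card T * (c * real (card T) * B / 4)"
    using \<open>finite T\<close> by (simp add: card_Pow)
  finally show False by simp
qed

section \<open>One row of the matrix\<close>

text \<open>A set of columns is determined by its traces on the blocks, which can be chosen independently.\<close>

lemma card_sets_with_block_counts:
  assumes z: "z \<in> {1..m} \<rightarrow> {1..L}"
  shows "card {S. S \<subseteq> {1..m} \<and> (\<forall>l\<in>{1..L}. card {j \<in> S. z j = l} = X l)}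
           = (\<Prod>l=1..L. label_count m z l choose X l)"
    (is "card ?F = _")
proof -
  define G where "G = (\<lambda>l. {H. H \<subseteq> {j \<in> {1..m}. z j = l} \<and> card H = X l})"
  have "bij_betw (\<lambda>S. \<lambda>l\<in>{1..L}. {j \<in> S. z j = l}) ?F (Pi\<^sub>E {1..L} G)"
  proof (rule bij_betwI)
    show "(\<lambda>S. \<lambda>l\<in>{1..L}. {j \<in> S. z j = l}) \<in> ?F \<rightarrow> Pi\<^sub>E {1..L} G"
      by (auto simp: G_def)
    have blk: "{j \<in> (\<Union>l\<in>{1..L}. H l). z j = l} = H l" if "H \<in> Pi\<^sub>E {1..L} G" "l \<in> {1..L}" for H l
      using that by (fastforce simp: G_def PiE_iff)
    show "(\<lambda>H. \<Union>l\<in>{1..L}. H l) \<in> Pi\<^sub>E {1..L} G \<rightarrow> ?F"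
    proof
      fix H assume H: "H \<in> Pi\<^sub>E {1..L} G"
      have "card {j \<in> (\<Union>l\<in>{1..L}. H l). z j = l} = X l" if "l \<in> {1..L}" for l
        unfolding blk[OF H that] using H that by (auto simp: G_def PiE_iff)
      moreover have "(\<Union>l\<in>{1..L}. H l) \<subseteq> {1..m}"
        using H by (fastforce simp: G_def PiE_iff)
      ultimately show "(\<Union>l\<in>{1..L}. H l) \<in> ?F" by blast
    qed
    show "(\<Union>l\<in>{1..L}. (\<lambda>l\<in>{1..L}. {j \<in> S. z j = l}) l) = S" if "S \<in> ?F" for S
      using that z by (fastforce simp: Pi_iff)
    show "(\<lambda>l\<in>{1..L}. {j \<in> (\<Union>l\<in>{1..L}. H l). z j = l}) = H" if "H \<in> Pi\<^sub>E {1..L} G" for H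
    proof
      fix l show "(\<lambda>l\<in>{1..L}. {j \<in> (\<Union>l\<in>{1..L}. H l). z j = l}) l = H l"
        using blk[OF that, of l] that by (cases "l \<in> {1..L}") (auto simp: PiE_iff extensional_def)
    qed
  qed
  then have "card ?F = (\<Prod>l=1..L. card (G l))"
    by (simp add: bij_betw_same_card card_PiE)
  also have "\<dots> = (\<Prod>l=1..L. label_count m z l choose X l)"
    by (intro prod.cong) (simp_all add: G_def n_subsets label_count_def)
  finally show ?thesis .
qed

lemma Bernoulli_likelihood_by_blocks:
  fixes p :: "nat \<Rightarrow> real"
  assumes z: "z \<in> {1..m} \<rightarrow> {1..L}" and S: "S \<subseteq> {1..m}"
    and X: "\<And>l. l \<in> {1..L} \<Longrightarrow> card {j \<in> S. z j = l} = X l"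
  shows "(\<Prod>j=1..m. if j \<in> S then p (z j) else 1 - p (z j))
           = (\<Prod>l=1..L. p l ^ X l * (1 - p l) ^ (label_count m z l - X l))"
proof -
  let ?h = "\<lambda>j. if j \<in> S then p (z j) else 1 - p (z j)"
  have "finite S" using S by (rule finite_subset) simp
  have "(\<Prod>j=1..m. ?h j) = (\<Prod>l=1..L. \<Prod>j | j \<in> {1..m} \<and> z j = l. ?h j)"
    using z by (intro prod.group[symmetric]) auto
  also have "\<dots> = (\<Prod>l=1..L. p l ^ X l * (1 - p l) ^ (label_count m z l - X l))"
  proof (rule prod.cong[OF refl])
    fix l assume l: "l \<in> {1..L}"
    have un: "{j. j \<in> {1..m} \<and> z j = l} = {j \<in> S. z j = l} \<union> {j \<in> {1..m} - S. z j = l}"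
      using S by auto
    have "(\<Prod>j | j \<in> {1..m} \<and> z j = l. ?h j)
        = (\<Prod>j\<in>{j \<in> S. z j = l}. ?h j) * (\<Prod>j\<in>{j \<in> {1..m} - S. z j = l}. ?h j)"
      unfolding un using \<open>finite S\<close> by (intro prod.union_disjoint) auto
    also have "(\<Prod>j\<in>{j \<in> S. z j = l}. ?h j) = (\<Prod>j\<in>{j \<in> S. z j = l}. p l)"
      by (intro prod.cong) auto
    also have "(\<Prod>j\<in>{j \<in> {1..m} - S. z j = l}. ?h j) = (\<Prod>j\<in>{j \<in> {1..m} - S. z j = l}. 1 - p l)"
      by (intro prod.cong) auto
    also have "card {j \<in> {1..m} - S. z j = l} = label_count m z l - X l"
    proof -
      have "label_count m z l = card {j \<in> S. z j = l} + card {j \<in> {1..m} - S. z j = l}"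
        unfolding label_count_def un using \<open>finite S\<close> by (intro card_Un_disjoint) auto
      then show ?thesis using X[OF l] by simp
    qed
    ultimately show "(\<Prod>j | j \<in> {1..m} \<and> z j = l. ?h j)
        = p l ^ X l * (1 - p l) ^ (label_count m z l - X l)"
      using X[OF l] \<open>card {j \<in> {1..m} - S. z j = l} = _\<close> by simp
  qed
  finally show ?thesis .
qed

text \<open>
  If \<open>y\<close> and \<open>y'\<close> differ in row \<open>i\<close> alone, only that row distinguishes the two laws. All row
  patterns with \<open>X l\<close> ones in block \<open>l\<close> have the same likelihood, so keeping just these patterns
  bounds the affinity below by the smaller of two products, over the blocks, of binomial
  probabilities.
\<close>

lemma SBM_testing_errors:
  assumes i: "i \<in> {1..n}" and y: "\<And>i'. i' \<in> {1..n} - {i} \<Longrightarrow> y i' = y' i'"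
    and z: "z \<in> {1..m} \<rightarrow> {1..L}"
    and P: "\<And>l. l \<in> {1..L} \<Longrightarrow> P (y i, l) \<in> {0..1}" "\<And>l. l \<in> {1..L} \<Longrightarrow> P (y' i, l) \<in> {0..1}"
    and B: "\<And>k. k \<in> {y i, y' i} \<Longrightarrow>
      B \<le> (\<Prod>l=1..L. real (label_count m z l choose X l) *
              (P (k, l) ^ X l * (1 - P (k, l)) ^ (label_count m z l - X l)))"
  shows "B \<le> measure_pmf.prob (SBM n m y z P) D + measure_pmf.prob (SBM n m y' z P) (- D)"
proof -
  define F where "F = {S. S \<subseteq> {1..m} \<and> (\<forall>l\<in>{1..L}. card {j \<in> S. z j = l} = X l)}"
  define row where "row = (\<lambda>S (i', j). i' = i \<and> j \<in> (S :: nat set))"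
  define f where "f = (\<lambda>y (i :: nat, j). bernoulli_pmf (P (y i, z j)))"
  define w where "w = (\<lambda>k. \<Prod>l=1..L. P (k, l) ^ X l * (1 - P (k, l)) ^ (label_count m z l - X l))"
  let ?J = "{i} \<times> {1..m}"
  have "finite F" unfolding F_def by (rule finite_subset[of _ "Pow {1..m}"]) auto
  have inj: "inj_on row F"
    by (rule inj_on_inverseI[of _ "\<lambda>u. {j. u (i, j)}"]) (auto simp: row_def)
  have pmf_row: "pmf (Pi_pmf ?J False (f v)) (row S) = w (v i)"
    if S: "S \<in> F" and v: "\<And>l. l \<in> {1..L} \<Longrightarrow> P (v i, l) \<in> {0..1}" for S v
  proof -
    have "pmf (Pi_pmf ?J False (f v)) (row S) = (\<Prod>x\<in>?J. pmf (f v x) (row S x))"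
      using S by (intro pmf_Pi') (auto simp: row_def F_def)
    also have "\<dots> = (\<Prod>j=1..m. pmf (f v (i, j)) (row S (i, j)))"
    proof -
      have "?J = Pair i ` {1..m}" by auto
      then show ?thesis by (simp only:) (subst prod.reindex, auto simp: inj_on_def)
    qed
    also have "\<dots> = (\<Prod>j=1..m. if j \<in> S then P (v i, z j) else 1 - P (v i, z j))"
    proof (rule prod.cong[OF refl])
      fix j assume "j \<in> {1..m}"
      then have "P (v i, z j) \<in> {0..1}" by (intro v Pi_mem[OF z])
      then show "pmf (f v (i, j)) (row S (i, j)) = (if j \<in> S then P (v i, z j) else 1 - P (v i, z j))"
        by (auto simp: f_def row_def)
    qed
    also have "\<dots> = w (v i)"
      unfolding w_def using S z
      by (intro Bernoulli_likelihood_by_blocks[where p="\<lambda>l. P (v i, l)"]) (auto simp: F_def)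
    finally show ?thesis .
  qed
  have card: "real (card F) = (\<Prod>l=1..L. real (label_count m z l choose X l))"
    unfolding F_def card_sets_with_block_counts[OF z] by simp
  have "B \<le> real (card F) * w k" if "k \<in> {y i, y' i}" for k
    using B[OF that] unfolding card w_def by (simp add: prod.distrib)
  then have "B \<le> real (card F) * min (w (y i)) (w (y' i))"
    by (auto simp: min_def)
  also have "\<dots> = (\<Sum>u\<in>row ` F. min (pmf (Pi_pmf ?J False (f y)) u) (pmf (Pi_pmf ?J False (f y')) u))"
  proof -
    have "(\<Sum>u\<in>row ` F. min (pmf (Pi_pmf ?J False (f y)) u) (pmf (Pi_pmf ?J False (f y')) u))
        = (\<Sum>S\<in>F. min (w (y i)) (w (y' i)))"
      unfolding sum.reindex[OF inj] o_def
      by (intro sum.cong refl arg_cong2[where f=min] pmf_row P)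
    then show ?thesis by simp
  qed
  also have "\<dots> \<le> measure_pmf.prob (Pi_pmf ({1..n} \<times> {1..m}) False (f y)) D
      + measure_pmf.prob (Pi_pmf ({1..n} \<times> {1..m}) False (f y')) (- D)"
  proof (rule affinity_le_testing_errors_Pi_pmf)
    show "f y x = f y' x" if "x \<in> {1..n} \<times> {1..m} - ?J" for x
      using that y[of "fst x"] by (cases x) (auto simp: f_def)
  qed (use i \<open>finite F\<close> in auto)
  finally show ?thesis by (simp add: SBM_def f_def)
qed

lemma finite_set_SBM: "finite (set_pmf (SBM n m y z P))"
proof -
  have "set_pmf (SBM n m y z P) \<subseteq> PiE_dflt ({1..n} \<times> {1..m}) False (\<lambda>_. UNIV)"
    unfolding SBM_def by (subst set_Pi_pmf) (auto simp: PiE_dflt_def)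
  then show ?thesis by (rule finite_subset) auto
qed

section \<open>The misclassification rate\<close>

lemma Mis_attained:
  obtains \<sigma> where "\<sigma> permutes {1..K}"
    "Mis n K g y = real (card {i \<in> {1..n}. \<sigma> (g i) \<noteq> y i}) / real n"
proof -
  let ?h = "\<lambda>\<sigma>. (\<Sum>i=1..n. of_bool (\<sigma> (g i) \<noteq> y i)) / real n"
  have "Mis n K g y \<in> ?h ` {\<sigma>. \<sigma> permutes {1..K}}"
    unfolding Mis_def
  proof (rule Min_in)
    show "?h ` {\<sigma>. \<sigma> permutes {1..K}} \<noteq> {}"
      using permutes_id[of "{1..K}"] by blast
  qed (auto simp: finite_permutations)
  then obtain \<sigma> where "\<sigma> permutes {1..K}" "Mis n K g y = ?h \<sigma>" by auto
  moreover have "(\<Sum>i=1..n. of_bool (\<sigma> (g i) \<noteq> y i)) = real (card {i \<in> {1..n}. \<sigma> (g i) \<noteq> y i})"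
    by (simp add: sum_of_bool_eq Int_def)
  ultimately show ?thesis using that by simp
qed

lemma Mis_bounds: "0 \<le> Mis n K g y" "Mis n K g y \<le> 1"
proof -
  obtain \<sigma> where \<sigma>: "Mis n K g y = real (card {i \<in> {1..n}. \<sigma> (g i) \<noteq> y i}) / real n"
    by (rule Mis_attained)
  have "card {i \<in> {1..n}. \<sigma> (g i) \<noteq> y i} \<le> card {1..n}"
    by (intro card_mono) auto
  then show "0 \<le> Mis n K g y" "Mis n K g y \<le> 1"
    unfolding \<sigma> by (auto simp: divide_le_eq)
qed

text \<open>
  If the permutations that are optimal for \<open>y\<close> and for \<open>y'\<close> agree, every \<open>i\<close> with
  \<open>y i \<noteq> y' i\<close> is an error for one of them. If they disagree, they send different labels to some
  cluster \<open>a\<close>, and then every row outside \<open>T\<close> in cluster \<open>a\<close> is an error for one of them; by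
  assumption there are at least \<open>|T|\<close> such rows, as many as \<open>y\<close> and \<open>y'\<close> can differ in.
\<close>

lemma Mis_separation:
  assumes n: "n > 0" and T: "T \<subseteq> {1..n}"
    and y: "\<And>i. i \<in> {1..n} - T \<Longrightarrow> y i = y0 i" "\<And>i. i \<in> {1..n} - T \<Longrightarrow> y' i = y0 i"
    and big: "\<And>a. a \<in> {1..K} \<Longrightarrow> card T \<le> card {i \<in> {1..n} - T. y0 i = a}"
  shows "real (card {i \<in> {1..n}. y i \<noteq> y' i}) / real n \<le> Mis n K g y + Mis n K g y'"
proof -
  obtain \<sigma> where \<sigma>: "\<sigma> permutes {1..K}" "Mis n K g y = real (card {i \<in> {1..n}. \<sigma> (g i) \<noteq> y i}) / real n"
    by (rule Mis_attained)
  obtain \<tau> where \<tau>: "\<tau> permutes {1..K}" "Mis n K g y' = real (card {i \<in> {1..n}. \<tau> (g i) \<noteq> y' i}) / real n"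
    by (rule Mis_attained)
  let ?A = "{i \<in> {1..n}. \<sigma> (g i) \<noteq> y i}" and ?B = "{i \<in> {1..n}. \<tau> (g i) \<noteq> y' i}"
  have "card {i \<in> {1..n}. y i \<noteq> y' i} \<le> card (?A \<union> ?B)"
  proof (cases "\<sigma> = \<tau>")
    case True
    then show ?thesis by (intro card_mono) auto
  next
    case False
    then have "inv \<sigma> \<noteq> inv \<tau>"
      using permutes_inv_inv[OF \<sigma>(1)] permutes_inv_inv[OF \<tau>(1)] by metis
    then obtain a where a: "inv \<sigma> a \<noteq> inv \<tau> a" by auto
    then have aK: "a \<in> {1..K}"
      using permutes_not_in[OF permutes_inv[OF \<sigma>(1)]] permutes_not_in[OF permutes_inv[OF \<tau>(1)]] by metis
    have "card {i \<in> {1..n}. y i \<noteq> y' i} \<le> card T"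
    proof (intro card_mono)
      show "finite T" using T by (rule finite_subset) simp
      show "{i \<in> {1..n}. y i \<noteq> y' i} \<subseteq> T"
      proof (rule subsetI, rule ccontr)
        fix i assume "i \<in> {i \<in> {1..n}. y i \<noteq> y' i}" "i \<notin> T"
        then show False using y[of i] by simp
      qed
    qed
    also have "\<dots> \<le> card {i \<in> {1..n} - T. y0 i = a}"
      by (rule big) fact
    also have "\<dots> \<le> card (?A \<union> ?B)"
    proof (intro card_mono)
      show "{i \<in> {1..n} - T. y0 i = a} \<subseteq> ?A \<union> ?B"
      proof (rule subsetI, rule ccontr)
        fix i assume i: "i \<in> {i \<in> {1..n} - T. y0 i = a}" "i \<notin> ?A \<union> ?B"
        then have "\<sigma> (g i) = a" "\<tau> (g i) = a" using y[of i] by auto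
        then have "inv \<sigma> a = g i" "inv \<tau> a = g i"
          using permutes_inv_eq[OF \<sigma>(1)] permutes_inv_eq[OF \<tau>(1)] by blast+
        then show False using a by simp
      qed
    qed auto
    finally show ?thesis .
  qed
  also have "\<dots> \<le> card ?A + card ?B" by (rule card_Un_le)
  finally show ?thesis
    unfolding \<sigma>(2) \<tau>(2) using n by (simp add: divide_right_mono flip: add_divide_distrib of_nat_add)
qed

definition cyclic_labels :: "nat \<Rightarrow> nat \<Rightarrow> nat \<Rightarrow> nat" where
  "cyclic_labels n K = (\<lambda>i\<in>{1..n}. Suc ((i - 1) mod K))"

lemma label_count_cyclic_labels:
  assumes "a \<in> {1..K}"
  shows "n div K \<le> label_count n (cyclic_labels n K) a"
    "label_count n (cyclic_labels n K) a \<le> Suc (n div K)"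
proof -
  have K: "K > 0" using assms by auto
  let ?C = "{i \<in> {1..n}. cyclic_labels n K i = a}"
  let ?e = "\<lambda>q. a + K * q"
  have inj: "inj_on ?e X" for X using K by (auto simp: inj_on_def)
  have "?e ` {..<n div K} \<subseteq> ?C"
  proof
    fix i assume "i \<in> ?e ` {..<n div K}"
    then obtain q where q: "q < n div K" "i = a + K * q" by auto
    have "K * Suc q \<le> K * (n div K)" using q by (intro mult_le_mono) auto
    also have "\<dots> \<le> n" by simp
    finally have "i \<le> n" using q assms by simp
    moreover have "(i - 1) mod K = a - 1"
    proof -
      have "i - 1 = (a - 1) + K * q" "a - 1 < K" using assms q by auto
      then show ?thesis by (simp only: mod_mult_self2 mod_less)
    qed
    ultimately show "i \<in> ?C" using assms q by (auto simp: cyclic_labels_def)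
  qed
  then have "card (?e ` {..<n div K}) \<le> card ?C" by (intro card_mono) auto
  then show "n div K \<le> label_count n (cyclic_labels n K) a"
    by (simp add: label_count_def card_image[OF inj])
  have "?C \<subseteq> ?e ` {..n div K}"
  proof
    fix i assume "i \<in> ?C"
    then have i: "i \<in> {1..n}" "Suc ((i - 1) mod K) = a" by (auto simp: cyclic_labels_def)
    have "i = a + K * ((i - 1) div K)"
      using i mod_mult_div_eq[of "i - 1" K] by auto
    moreover have "(i - 1) div K \<le> n div K" using i by (intro div_le_mono) auto
    ultimately show "i \<in> ?e ` {..n div K}" by blast
  qed
  then have "card ?C \<le> card (?e ` {..n div K})" by (intro card_mono) auto
  then show "label_count n (cyclic_labels n K) a \<le> Suc (n div K)"
    by (simp add: label_count_def card_image[OF inj])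
qed

section \<open>Poisson bounds\<close>

text \<open>
  A Stirling bound that is weak by a factor of order \<open>\<surd>X\<close>. The loss is harmless below, since a factor
  of the order of the information is allowed for each block.
\<close>

lemma ln_fact_le:
  assumes "X \<ge> 1"
  shows "ln (fact X) \<le> real X * ln (real X) - real X + ln (real X) + 1"
  using assms
proof (induction X rule: nat_induct_at_least)
  case base
  then show ?case by simp
next
  case (Suc X)
  have "ln (real X / real (Suc X)) \<le> real X / real (Suc X) - 1"
    using Suc.hyps by (intro ln_le_minus_one) auto
  then have "ln (real X) - ln (real (Suc X)) \<le> - 1 / real (Suc X)"
    using Suc.hyps by (subst (asm) ln_div) (auto simp: field_simps)
  then have "(ln (real X) - ln (real (Suc X))) * real (Suc X) \<le> - 1 / real (Suc X) * real (Suc X)"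
    by (intro mult_right_mono) auto
  then have "(ln (real X) - ln (real (Suc X))) * real (Suc X) \<le> - 1"
    by (simp del: of_nat_Suc)
  moreover have "ln (fact (Suc X)) = ln (real (Suc X)) + ln (fact X :: real)"
    by (simp add: ln_mult)
  ultimately show ?case using Suc.IH by (simp add: algebra_simps)
qed

lemma exp_le_one_minus_power:
  fixes u :: real
  assumes "0 \<le> u" "u \<le> 1/2"
  shows "exp (- real k * (u + 2 * u\<^sup>2)) \<le> (1 - u) ^ k"
proof -
  have "exp (- (u + 2 * u\<^sup>2)) \<le> exp (ln (1 - u))"
    using ln_one_minus_pos_lower_bound[OF assms] by simp
  also have "\<dots> = 1 - u" using assms by simp
  finally have "exp (- (u + 2 * u\<^sup>2)) ^ k \<le> (1 - u) ^ k"
    by (intro power_mono) auto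
  moreover have "exp (- real k * (u + 2 * u\<^sup>2)) = exp (- (u + 2 * u\<^sup>2)) ^ k"
    by (subst exp_of_nat_mult[symmetric]) (simp add: algebra_simps)
  ultimately show ?thesis by simp
qed

lemma power_le_fact_mult_binomial:
  assumes "X \<le> N"
  shows "(real N - real X) ^ X \<le> fact X * real (N choose X)"
proof -
  have "(real N - real X) ^ X = (\<Prod>i<X. real N - real X)" by simp
  also have "\<dots> \<le> (\<Prod>i<X. real N - real i)"
    using assms by (intro prod_mono) auto
  also have "\<dots> = fact X * real (N choose X)"
    by (simp add: binomial_gbinomial gbinomial_prod_rev atLeast0LessThan)
  finally show ?thesis .
qed

text \<open>
  The two corrections, \<open>(1 - X / N)\<^sup>X\<close> for the falling factorial and \<open>(1 - a / N)\<^sup>N exp a\<close> for the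
  failures, are each at least \<open>exp (- 2 D)\<close>, since \<open>X\<^sup>2 / N\<close> and \<open>a\<^sup>2 / N\<close> are at most \<open>D\<close>.
\<close>

lemma Poisson_le_binomial:
  fixes a D :: real
  assumes N: "N > 0" and a: "0 \<le> a" "a \<le> real N / 2" "a\<^sup>2 \<le> D * real N"
    and X: "real X \<le> real N / 2" "(real X)\<^sup>2 \<le> D * real N"
  shows "exp (- 4 * D) * (a ^ X * exp (- a) / fact X)
           \<le> real (N choose X) * ((a / real N) ^ X * (1 - a / real N) ^ (N - X))"
proof -
  let ?u = "real X / real N" and ?p = "a / real N"
  have N': "real N > 0" using N by simp
  have u: "0 \<le> ?u" "?u \<le> 1/2" using X N' by (auto simp: field_simps)
  have p: "0 \<le> ?p" "?p \<le> 1/2" using a N' by (auto simp: field_simps)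
  have "real X * (?u + 2 * ?u\<^sup>2) \<le> 2 * D"
  proof -
    have "?u * ?u \<le> 1/2 * ?u" using u by (intro mult_right_mono)
    then have "real X * (?u + 2 * ?u\<^sup>2) \<le> real X * (2 * ?u)"
      by (intro mult_left_mono) (auto simp: power2_eq_square)
    also have "\<dots> = 2 * ((real X)\<^sup>2 / real N)" by (simp add: power2_eq_square)
    also have "\<dots> \<le> 2 * D" using X(2) N' by (simp add: pos_divide_le_eq)
    finally show ?thesis .
  qed
  then have "exp (- 2 * D) \<le> exp (- real X * (?u + 2 * ?u\<^sup>2))" by simp
  also have "\<dots> \<le> (1 - ?u) ^ X" by (rule exp_le_one_minus_power) fact+
  finally have "exp (- 2 * D) * real N ^ X \<le> (1 - ?u) ^ X * real N ^ X"
    by (intro mult_right_mono) auto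
  also have "\<dots> = (real N - real X) ^ X"
    using N' by (simp add: field_simps flip: power_mult_distrib)
  also have "\<dots> \<le> fact X * real (N choose X)"
    using X by (intro power_le_fact_mult_binomial) auto
  finally have 1: "exp (- 2 * D) * real N ^ X / fact X \<le> real (N choose X)"
    by (simp add: field_simps)
  have "real N * (?p + 2 * ?p\<^sup>2) = a + 2 * (a\<^sup>2 / real N)"
    using N' by (simp add: field_simps power2_eq_square)
  also have "\<dots> \<le> a + 2 * D" using a(3) N' by (simp add: pos_divide_le_eq)
  finally have "exp (- a - 2 * D) \<le> exp (- real N * (?p + 2 * ?p\<^sup>2))" by simp
  also have "\<dots> \<le> (1 - ?p) ^ N" by (rule exp_le_one_minus_power) fact+
  also have "\<dots> \<le> (1 - ?p) ^ (N - X)" using p by (intro power_decreasing) linarith+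
  finally have 2: "exp (- a - 2 * D) \<le> (1 - ?p) ^ (N - X)" .
  have "exp (- 4 * D) * (a ^ X * exp (- a) / fact X)
      = (exp (- 2 * D) * real N ^ X / fact X) * (?p ^ X * exp (- a - 2 * D))"
  proof -
    have "exp (- 4 * D) * exp (- a) = exp (- 2 * D) * exp (- a - 2 * D)"
      by (simp flip: exp_add)
    moreover have "real N ^ X * ?p ^ X = a ^ X"
      using N' by (simp flip: power_mult_distrib)
    moreover have "(exp (- 2 * D) * real N ^ X / fact X) * (?p ^ X * exp (- a - 2 * D))
        = (real N ^ X * ?p ^ X) * (exp (- 2 * D) * exp (- a - 2 * D)) / fact X"
      by (simp only: times_divide_eq_left times_divide_eq_right mult_ac)
    ultimately show ?thesis by (simp only: times_divide_eq_right mult_ac)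
  qed
  also have "\<dots> \<le> real (N choose X) * (?p ^ X * (1 - ?p) ^ (N - X))"
    using p by (intro mult_mono mult_left_mono 1 2) auto
  finally show ?thesis .
qed

text \<open>
  Since \<open>ln x = ln a + s (ln b - ln a)\<close>, at the real point \<open>x\<close> the Poisson log likelihood
  \<open>x ln a - a - (x ln x - x)\<close> is \<open>- s x (ln b - ln a) + (x - a)\<close>. Rounding \<open>x\<close> down costs at most
  \<open>r + 1\<close>, and the factorial bound \<open>ln M + 1\<close>. The statement also serves \<open>b\<close>, with \<open>a\<close>, \<open>b\<close>
  exchanged and \<open>1 - s\<close> for \<open>s\<close>, which leaves \<open>x\<close> unchanged.
\<close>

lemma Poisson_mass_at_geometric_mean:
  fixes a b s M r :: real
  assumes "a \<ge> 1" "b \<ge> 1" "a \<le> M" "b \<le> M" and s: "0 < s" "s < 1"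
    and r: "\<bar>ln b - ln a\<bar> \<le> r"
  defines "x \<equiv> a powr (1 - s) * b powr s"
  shows "exp (- s * (x * (ln b - ln a)) + (x - a) - (ln M + r + 2))
           \<le> a ^ nat \<lfloor>x\<rfloor> * exp (- a) / fact (nat \<lfloor>x\<rfloor>)"
proof -
  have lnx: "ln x = ln a + s * (ln b - ln a)"
    unfolding x_def using assms by (simp add: ln_mult ln_powr algebra_simps)
  have "ln a \<ge> 0" "ln b \<ge> 0" "ln a \<le> ln M" "ln b \<le> ln M" using assms by auto
  have xpos: "x > 0" using assms by (simp add: x_def)
  have "ln x = (1 - s) * ln a + s * ln b" by (simp add: lnx algebra_simps)
  moreover have "(1 - s) * ln a + s * ln b \<ge> 0" using \<open>ln a \<ge> 0\<close> \<open>ln b \<ge> 0\<close> s by simp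
  moreover have "(1 - s) * ln a + s * ln b \<le> (1 - s) * ln M + s * ln M"
    using \<open>ln a \<le> ln M\<close> \<open>ln b \<le> ln M\<close> s by (intro add_mono mult_left_mono) auto
  ultimately have "ln x \<ge> 0" "ln x \<le> ln M" by (auto simp: algebra_simps)
  then have x1: "x \<ge> 1" using xpos by simp
  define X where "X = nat \<lfloor>x\<rfloor>"
  have X: "X \<ge> 1" "real X \<le> x" "x \<le> real X + 1" using x1 unfolding X_def by linarith+
  have "ln (fact X) \<le> real X * ln (real X) - real X + ln (real X) + 1"
    by (rule ln_fact_le) fact
  also have "\<dots> \<le> real X * ln x - real X + ln x + 1"
    using X xpos by (intro add_mono diff_mono mult_left_mono) auto
  finally have f: "ln (fact X) \<le> real X * ln x - real X + ln M + 1" using \<open>ln x \<le> ln M\<close> by simp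
  have "\<bar>s * (x - real X) * (ln b - ln a)\<bar> \<le> 1 * r"
    unfolding abs_mult using s X r by (intro mult_mono) (auto intro: mult_le_one)
  then have "- s * (x * (ln b - ln a)) + (x - a) - (ln M + r + 2)
     \<le> - s * (real X * (ln b - ln a)) + (real X - a) - (ln M + 1)"
    using X by (simp add: algebra_simps)
  also have "\<dots> = real X * ln a - a - (real X * ln x - real X + ln M + 1)"
    by (simp add: lnx algebra_simps)
  also have "\<dots> \<le> real X * ln a - a - ln (fact X)" using f by simp
  finally have "exp (- s * (x * (ln b - ln a)) + (x - a) - (ln M + r + 2))
     \<le> exp (real X * ln a - a - ln (fact X))" by simp
  also have "\<dots> = a ^ X * exp (- a) / fact X"
  proof -
    have "exp (real X * ln a) = a ^ X" using \<open>a \<ge> 1\<close> by (simp add: exp_of_nat_mult)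
    moreover have "exp (ln (fact X)) = (fact X :: real)" by simp
    moreover have "exp (real X * ln a - a - ln (fact X)) = exp (real X * ln a) * exp (- a) / exp (ln (fact X))"
      by (simp only: exp_diff exp_minus divide_inverse)
    ultimately show ?thesis by (simp only:)
    qed
  finally show ?thesis by (simp add: X_def)
qed

section \<open>The information\<close>

text \<open>The function of \<open>s\<close> whose supremum over the open unit interval is \<^const>\<open>info\<close>.\<close>

definition chernoff :: "nat \<Rightarrow> (nat \<Rightarrow> nat \<Rightarrow> real) \<Rightarrow> nat \<Rightarrow> nat \<Rightarrow> real \<Rightarrow> real" where
  "chernoff L \<Lambda> k r s =
     (\<Sum>l=1..L. (1 - s) * \<Lambda> k l + s * \<Lambda> r l - \<Lambda> k l powr (1 - s) * \<Lambda> r l powr s)"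

lemma chernoff_le:
  assumes "\<And>l. l \<in> {1..L} \<Longrightarrow> 0 \<le> \<Lambda> k l \<and> \<Lambda> k l \<le> M" "\<And>l. l \<in> {1..L} \<Longrightarrow> 0 \<le> \<Lambda> r l \<and> \<Lambda> r l \<le> M"
    and s: "s \<in> {0<..<1}"
  shows "chernoff L \<Lambda> k r s \<le> real L * M"
proof -
  have "chernoff L \<Lambda> k r s \<le> (\<Sum>l=1..L. M)"
    unfolding chernoff_def
  proof (rule sum_mono)
    fix l assume l: "l \<in> {1..L}"
    have "(1 - s) * \<Lambda> k l + s * \<Lambda> r l \<le> (1 - s) * M + s * M"
      using assms(1,2)[OF l] s by (intro add_mono mult_left_mono) auto
    moreover have "0 \<le> \<Lambda> k l powr (1 - s) * \<Lambda> r l powr s" by simp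
    moreover have "(1 - s) * M + s * M = M" by (simp add: algebra_simps)
    ultimately show "(1 - s) * \<Lambda> k l + s * \<Lambda> r l - \<Lambda> k l powr (1 - s) * \<Lambda> r l powr s \<le> M"
      by linarith
  qed
  then show ?thesis by simp
qed

lemma info_bounds:
  assumes "\<And>l. l \<in> {1..L} \<Longrightarrow> 0 \<le> \<Lambda> k l \<and> \<Lambda> k l \<le> M" "\<And>l. l \<in> {1..L} \<Longrightarrow> 0 \<le> \<Lambda> r l \<and> \<Lambda> r l \<le> M"
  shows "info L \<Lambda> k r \<le> real L * M"
    and "s \<in> {0<..<1} \<Longrightarrow> chernoff L \<Lambda> k r s \<le> info L \<Lambda> k r"
proof -
  have info: "info L \<Lambda> k r = (SUP s\<in>{0<..<1}. chernoff L \<Lambda> k r s)"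
    by (simp add: info_def chernoff_def)
  have ne: "{0<..<1::real} \<noteq> {}" by auto
  have bound: "chernoff L \<Lambda> k r s \<le> real L * M" if "s \<in> {0<..<1}" for s
    using chernoff_le[of L \<Lambda> k M r s] assms that by blast
  show "info L \<Lambda> k r \<le> real L * M"
    unfolding info by (intro cSUP_least ne bound)
  show "s \<in> {0<..<1} \<Longrightarrow> chernoff L \<Lambda> k r s \<le> info L \<Lambda> k r"
    unfolding info using bound by (intro cSUP_upper bdd_aboveI2[where M="real L * M"]) auto
qed

text \<open>
  At \<open>s = 1/2\<close> each summand is half the square of \<open>\<surd>(\<Lambda> k l) - \<surd>(\<Lambda> r l)\<close>, so that a single block
  whose rates are apart by a factor \<open>1 + e\<close> already gives information of the order of its rates.
\<close>

lemma info_ge_if_ratio: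
  assumes pos: "\<And>l. l \<in> {1..L} \<Longrightarrow> 0 < \<Lambda> k l \<and> \<Lambda> k l \<le> M" "\<And>l. l \<in> {1..L} \<Longrightarrow> 0 < \<Lambda> r l \<and> \<Lambda> r l \<le> M"
    and l: "l \<in> {1..L}" and e: "e \<ge> 0"
    and low: "\<mu> \<ge> 0" "\<mu> \<le> \<Lambda> k l" "\<mu> \<le> \<Lambda> r l"
    and ratio: "(1 + e) * \<Lambda> r l \<le> \<Lambda> k l \<or> (1 + e) * \<Lambda> k l \<le> \<Lambda> r l"
  shows "(sqrt (1 + e) - 1)\<^sup>2 / 2 * \<mu> \<le> info L \<Lambda> k r"
proof -
  have half: "(1 - 1/2) * \<Lambda> k l + 1/2 * \<Lambda> r l - \<Lambda> k l powr (1 - 1/2) * \<Lambda> r l powr (1/2)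
      = (sqrt (\<Lambda> k l) - sqrt (\<Lambda> r l))\<^sup>2 / 2" if "l \<in> {1..L}" for l
    using pos(1,2)[OF that] by (simp add: powr_half_sqrt power2_diff field_simps)
  have step: "(sqrt (1 + e) - 1)\<^sup>2 * \<mu> \<le> (sqrt b - sqrt a)\<^sup>2"
    if "\<mu> \<le> a" "(1 + e) * a \<le> b" for a b :: real
  proof -
    have "sqrt (1 + e) * sqrt a \<le> sqrt b" using that by (simp flip: real_sqrt_mult)
    then have *: "(sqrt (1 + e) - 1) * sqrt a \<le> sqrt b - sqrt a" by (simp add: algebra_simps)
    have a: "a \<ge> 0" using low that by simp
    have "(sqrt (1 + e) - 1)\<^sup>2 * \<mu> \<le> (sqrt (1 + e) - 1)\<^sup>2 * a"
      using that by (intro mult_left_mono) auto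
    also have "\<dots> = ((sqrt (1 + e) - 1) * sqrt a)\<^sup>2" using a by (simp add: power_mult_distrib)
    also have "\<dots> \<le> (sqrt b - sqrt a)\<^sup>2" using * e a by (intro power_mono) auto
    finally show ?thesis .
  qed
  have "(sqrt (1 + e) - 1)\<^sup>2 * \<mu> \<le> (sqrt (\<Lambda> k l) - sqrt (\<Lambda> r l))\<^sup>2"
    using ratio step[of "\<Lambda> k l" "\<Lambda> r l"] step[of "\<Lambda> r l" "\<Lambda> k l"] low
    by (auto simp: power2_commute)
  then have "(sqrt (1 + e) - 1)\<^sup>2 / 2 * \<mu> \<le> (sqrt (\<Lambda> k l) - sqrt (\<Lambda> r l))\<^sup>2 / 2" by simp
  also have "\<dots> \<le> (\<Sum>l=1..L. (sqrt (\<Lambda> k l) - sqrt (\<Lambda> r l))\<^sup>2 / 2)"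
    using l by (intro member_le_sum) auto
  also have "\<dots> = chernoff L \<Lambda> k r (1/2)"
    unfolding chernoff_def by (intro sum.cong refl half[symmetric])
  also have "\<dots> \<le> info L \<Lambda> k r"
    using pos by (intro info_bounds(2)[where M=M]) (auto intro: less_imp_le)
  finally show ?thesis .
qed

text \<open>
  The Chernoff function vanishes at \<open>s = 0\<close> and \<open>s = 1\<close>, so Rolle's theorem gives a stationary
  point strictly between. Any stationary point will do: its value is at most the supremum, which
  is the direction needed for a lower bound on likelihoods.
\<close>

lemma chernoff_stationary:
  fixes \<Lambda> :: "nat \<Rightarrow> nat \<Rightarrow> real"
  assumes pos: "\<And>l. l \<in> {1..L} \<Longrightarrow> \<Lambda> k l > 0 \<and> \<Lambda> r l > 0"
  obtains s where "0 < s" "s < 1"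
    "(\<Sum>l=1..L. \<Lambda> k l powr (1 - s) * \<Lambda> r l powr s * (ln (\<Lambda> r l) - ln (\<Lambda> k l)))
       = (\<Sum>l=1..L. \<Lambda> r l - \<Lambda> k l)"
proof -
  let ?d = "\<lambda>l. ln (\<Lambda> r l) - ln (\<Lambda> k l)"
  \<comment> \<open>The Chernoff function in exponential form, which extends smoothly to the end points.\<close>
  define f where "f = (\<lambda>s. \<Sum>l=1..L. (1 - s) * \<Lambda> k l + s * \<Lambda> r l - \<Lambda> k l * exp (s * ?d l))"
  have der: "(f has_real_derivative (\<Sum>l=1..L. \<Lambda> r l - \<Lambda> k l - \<Lambda> k l * (exp (s * ?d l) * ?d l))) (at s)" for s
  proof -
    have "((\<lambda>s. (1 - s) * \<Lambda> k l + s * \<Lambda> r l - \<Lambda> k l * exp (s * ?d l)) has_real_derivative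
        (\<Lambda> r l - \<Lambda> k l - \<Lambda> k l * (exp (s * ?d l) * ?d l))) (at s)" for l
      by (rule derivative_eq_intros refl | simp)+
    then show ?thesis unfolding f_def by (intro DERIV_sum)
  qed
  have f01: "f 0 = f 1"
    unfolding f_def
  proof (rule sum.cong[OF refl])
    fix l assume "l \<in> {1..L}"
    then have "\<Lambda> k l > 0" "\<Lambda> r l > 0" using pos by auto
    then show "(1 - 0) * \<Lambda> k l + 0 * \<Lambda> r l - \<Lambda> k l * exp (0 * ?d l)
        = (1 - 1) * \<Lambda> k l + 1 * \<Lambda> r l - \<Lambda> k l * exp (1 * ?d l)"
      by (simp add: exp_diff)
  qed
  have cont: "continuous_on {0..1} f"
    by (intro continuous_at_imp_continuous_on ballI DERIV_isCont[OF der])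
  have diff: "f differentiable (at s)" for s
    unfolding real_differentiable_def by (rule exI) (rule der)
  obtain s where s: "0 < s" "s < 1" "DERIV f s :> 0"
    using Rolle[OF zero_less_one f01 cont diff] by blast
  have tilt: "\<Lambda> k l powr (1 - s) * \<Lambda> r l powr s = \<Lambda> k l * exp (s * ?d l)" if "l \<in> {1..L}" for l
  proof -
    have p: "\<Lambda> k l > 0" "\<Lambda> r l > 0" using pos[OF that] by auto
    have "\<Lambda> k l * exp (s * ?d l) = exp (ln (\<Lambda> k l) + s * ?d l)"
      unfolding exp_add using p by simp
    also have "ln (\<Lambda> k l) + s * ?d l = (1 - s) * ln (\<Lambda> k l) + s * ln (\<Lambda> r l)"
      by (simp add: algebra_simps)
    also have "exp \<dots> = \<Lambda> k l powr (1 - s) * \<Lambda> r l powr s"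
      using p by (simp add: powr_def exp_add)
    finally show ?thesis by (rule sym)
  qed
  have "(\<Sum>l=1..L. \<Lambda> r l - \<Lambda> k l - \<Lambda> k l * (exp (s * ?d l) * ?d l)) = 0"
    using DERIV_unique[OF der s(3)] .
  then have "(\<Sum>l=1..L. \<Lambda> r l - \<Lambda> k l) = (\<Sum>l=1..L. \<Lambda> k l * (exp (s * ?d l) * ?d l))"
    by (simp only: sum_subtractf)
  also have "\<dots> = (\<Sum>l=1..L. \<Lambda> k l powr (1 - s) * \<Lambda> r l powr s * ?d l)"
    by (intro sum.cong refl) (simp only: tilt mult.assoc)
  finally have "(\<Sum>l=1..L. \<Lambda> r l - \<Lambda> k l)
      = (\<Sum>l=1..L. \<Lambda> k l powr (1 - s) * \<Lambda> r l powr s * ?d l)" .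
  from that[OF s(1,2) this[symmetric]] show ?thesis .
qed

text \<open>
  Summed over the blocks, the exponents \<open>- s x (ln b - ln a) + (x - a)\<close> for cluster \<open>k\<close> and
  \<open>(1 - s) x (ln b - ln a) + (x - b)\<close> for cluster \<open>r\<close> differ by the stationarity equation, hence
  not at all, and both equal minus the Chernoff function at \<open>s\<close>. So one common choice of \<open>X\<close> is
  equally good for both clusters.
\<close>

lemma block_binomials_at_chernoff_point:
  fixes \<Lambda> :: "nat \<Rightarrow> nat \<Rightarrow> real" and N :: "nat \<Rightarrow> nat" and M D \<rho> :: real
  assumes \<Lambda>: "\<And>k' l. k' \<in> {k, r} \<Longrightarrow> l \<in> {1..L} \<Longrightarrow> 1 \<le> \<Lambda> k' l \<and> \<Lambda> k' l \<le> M"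
    and \<rho>: "\<And>l. l \<in> {1..L} \<Longrightarrow> \<bar>ln (\<Lambda> r l) - ln (\<Lambda> k l)\<bar> \<le> \<rho>"
    and N: "\<And>l. l \<in> {1..L} \<Longrightarrow> N l > 0 \<and> M \<le> real (N l) / 2 \<and> M\<^sup>2 \<le> D * real (N l)"
  obtains X where "\<And>k'. k' \<in> {k, r} \<Longrightarrow>
    exp (- info L \<Lambda> k r - real L * (ln M + \<rho> + 2 + 4 * D))
      \<le> (\<Prod>l=1..L. real (N l choose X l) *
             ((\<Lambda> k' l / real (N l)) ^ X l * (1 - \<Lambda> k' l / real (N l)) ^ (N l - X l)))"
proof -
  obtain s where s: "0 < s" "s < 1" and stat:
    "(\<Sum>l=1..L. \<Lambda> k l powr (1 - s) * \<Lambda> r l powr s * (ln (\<Lambda> r l) - ln (\<Lambda> k l)))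
       = (\<Sum>l=1..L. \<Lambda> r l - \<Lambda> k l)"
    using \<Lambda> by (rule_tac chernoff_stationary[of L \<Lambda> k r]) (auto intro: less_le_trans[OF zero_less_one])
  define x where "x = (\<lambda>l. \<Lambda> k l powr (1 - s) * \<Lambda> r l powr s)"
  define d where "d = (\<lambda>l. ln (\<Lambda> r l) - ln (\<Lambda> k l))"
  define c where "c = ln M + \<rho> + 2"
  have info: "chernoff L \<Lambda> k r s \<le> info L \<Lambda> k r"
    using \<Lambda> s by (intro info_bounds(2)[where M=M]) (auto intro: order_trans[OF zero_le_one])
  have xd: "(\<Sum>l=1..L. x l * d l) = (\<Sum>l=1..L. \<Lambda> r l) - (\<Sum>l=1..L. \<Lambda> k l)"
    using stat by (simp add: x_def d_def sum_subtractf)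
  have ch: "chernoff L \<Lambda> k r s
      = (1 - s) * (\<Sum>l=1..L. \<Lambda> k l) + s * (\<Sum>l=1..L. \<Lambda> r l) - (\<Sum>l=1..L. x l)"
    by (simp add: chernoff_def x_def sum.distrib sum_subtractf sum_distrib_left)
  define X where "X = (\<lambda>l. nat \<lfloor>x l\<rfloor>)"
  \<comment> \<open>Common to both clusters: exponents \<open>g\<close> that sum to minus the Chernoff function suffice.\<close>
  have key: "exp (- info L \<Lambda> k r - real L * (ln M + \<rho> + 2 + 4 * D))
      \<le> (\<Prod>l=1..L. real (N l choose X l) *
             ((\<Lambda> k' l / real (N l)) ^ X l * (1 - \<Lambda> k' l / real (N l)) ^ (N l - X l)))"
    if k': "k' \<in> {k, r}" and g: "(\<Sum>l=1..L. g l) = - chernoff L \<Lambda> k r s"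
      and mass: "\<And>l. l \<in> {1..L} \<Longrightarrow> exp (g l - c) \<le> \<Lambda> k' l ^ X l * exp (- \<Lambda> k' l) / fact (X l)"
    for k' g
  proof -
    have "- info L \<Lambda> k r - real L * (ln M + \<rho> + 2 + 4 * D)
        \<le> - chernoff L \<Lambda> k r s - real L * (c + 4 * D)"
      using info by (simp add: c_def)
    also have "\<dots> = (\<Sum>l=1..L. - 4 * D + (g l - c))"
      by (simp add: g[symmetric] sum.distrib sum_subtractf sum_negf algebra_simps)
    finally have "exp (- info L \<Lambda> k r - real L * (ln M + \<rho> + 2 + 4 * D))
        \<le> (\<Prod>l=1..L. exp (- 4 * D + (g l - c)))" by (simp add: exp_sum[symmetric])
    also have "\<dots> \<le> (\<Prod>l=1..L. real (N l choose X l) *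
             ((\<Lambda> k' l / real (N l)) ^ X l * (1 - \<Lambda> k' l / real (N l)) ^ (N l - X l)))"
    proof (intro prod_mono conjI)
      fix l assume l: "l \<in> {1..L}"
      have a: "1 \<le> \<Lambda> k' l" "\<Lambda> k' l \<le> M" using \<Lambda> k' l by auto
      have "x l \<le> M powr (1 - s) * M powr s"
        unfolding x_def using \<Lambda>[of k l] \<Lambda>[of r l] l s by (intro mult_mono powr_mono2) auto
      also have "\<dots> = M" using a by (simp flip: powr_add)
      finally have "x l \<le> M" .
      moreover have "0 \<le> x l" by (simp add: x_def)
      ultimately have X: "real (X l) \<le> M" unfolding X_def by linarith
      have sq: "(\<Lambda> k' l)\<^sup>2 \<le> M\<^sup>2" "(real (X l))\<^sup>2 \<le> M\<^sup>2"
        using a X by (auto intro!: power_mono)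
      have "exp (- 4 * D + (g l - c)) \<le> exp (- 4 * D) * (\<Lambda> k' l ^ X l * exp (- \<Lambda> k' l) / fact (X l))"
        unfolding exp_add by (intro mult_left_mono mass l) auto
      also have "\<dots> \<le> real (N l choose X l) *
             ((\<Lambda> k' l / real (N l)) ^ X l * (1 - \<Lambda> k' l / real (N l)) ^ (N l - X l))"
        proof (intro Poisson_le_binomial)
          show "N l > 0" "\<Lambda> k' l \<le> real (N l) / 2" "real (X l) \<le> real (N l) / 2"
            using N[OF l] a X by auto
          show "(\<Lambda> k' l)\<^sup>2 \<le> D * real (N l)" "(real (X l))\<^sup>2 \<le> D * real (N l)"
            using N[OF l] sq by (auto intro: order_trans)
        qed (use a in auto)
      finally show "exp (- 4 * D + (g l - c)) \<le> real (N l choose X l) *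
             ((\<Lambda> k' l / real (N l)) ^ X l * (1 - \<Lambda> k' l / real (N l)) ^ (N l - X l))" .
    qed auto
    finally show ?thesis .
  qed
  have "exp (- info L \<Lambda> k r - real L * (ln M + \<rho> + 2 + 4 * D))
      \<le> (\<Prod>l=1..L. real (N l choose X l) *
             ((\<Lambda> k' l / real (N l)) ^ X l * (1 - \<Lambda> k' l / real (N l)) ^ (N l - X l)))"
    if "k' \<in> {k, r}" for k'
  proof (cases "k' = k")
    case True
    show ?thesis
    proof (rule key[OF that])
      have "(\<Sum>l=1..L. - s * (x l * d l) + (x l - \<Lambda> k l))
          = - s * (\<Sum>l=1..L. x l * d l) + (\<Sum>l=1..L. x l) - (\<Sum>l=1..L. \<Lambda> k l)"
        by (simp add: sum.distrib sum_subtractf sum_distrib_left sum_negf)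
      then show "(\<Sum>l=1..L. - s * (x l * d l) + (x l - \<Lambda> k l)) = - chernoff L \<Lambda> k r s"
        unfolding xd ch by (simp add: algebra_simps)
      fix l assume l: "l \<in> {1..L}"
      show "exp (- s * (x l * d l) + (x l - \<Lambda> k l) - c) \<le> \<Lambda> k' l ^ X l * exp (- \<Lambda> k' l) / fact (X l)"
        unfolding True x_def d_def X_def c_def
      proof (rule Poisson_mass_at_geometric_mean)
        show "\<bar>ln (\<Lambda> r l) - ln (\<Lambda> k l)\<bar> \<le> \<rho>" by (rule \<rho>[OF l])
      qed (use \<Lambda>[of k l] \<Lambda>[of r l] l s in auto)
    qed
  next
    case False
    then have k': "k' = r" using that by simp
    show ?thesis
    proof (rule key[OF that])
      have "(\<Sum>l=1..L. (1 - s) * (x l * d l) + (x l - \<Lambda> r l))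
          = (1 - s) * (\<Sum>l=1..L. x l * d l) + (\<Sum>l=1..L. x l) - (\<Sum>l=1..L. \<Lambda> r l)"
        by (simp add: sum.distrib sum_subtractf sum_distrib_left)
      then show "(\<Sum>l=1..L. (1 - s) * (x l * d l) + (x l - \<Lambda> r l)) = - chernoff L \<Lambda> k r s"
        unfolding xd ch by (simp add: algebra_simps)
      fix l assume l: "l \<in> {1..L}"
      have x: "\<Lambda> r l powr (1 - (1 - s)) * \<Lambda> k l powr (1 - s) = x l"
        by (simp add: x_def mult.commute)
      have d: "(1 - s) * (x l * d l) = - (1 - s) * (x l * (ln (\<Lambda> k l) - ln (\<Lambda> r l)))"
        by (simp add: d_def algebra_simps)
      show "exp ((1 - s) * (x l * d l) + (x l - \<Lambda> r l) - c) \<le> \<Lambda> k' l ^ X l * exp (- \<Lambda> k' l) / fact (X l)"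
        unfolding d k' X_def c_def
      proof (rule Poisson_mass_at_geometric_mean[of "\<Lambda> r l" "\<Lambda> k l" M "1 - s" \<rho>, unfolded x])
        show "\<bar>ln (\<Lambda> k l) - ln (\<Lambda> r l)\<bar> \<le> \<rho>" using \<rho>[OF l] by (simp add: abs_minus_commute)
      qed (use \<Lambda>[of k l] \<Lambda>[of r l] l s in auto)
    qed
  qed
  then show ?thesis by (rule that)
qed

section \<open>Consequences of membership in the class\<close>

text \<open>
  An instance that attains the information level \<open>Istar\<close>, for one fixed \<open>n\<close>. Everything up to the
  minimax bound is non-asymptotic and is developed in this context.
\<close>

locale sbm_instance =
  fixes Q :: nat and \<beta> \<omega> \<epsilon>star C3 \<nu> :: real and n m K L :: nat and Istar :: real
    and y z :: "nat \<Rightarrow> nat" and P :: "nat \<times> nat \<Rightarrow> real" and \<Lambda> :: "nat \<Rightarrow> nat \<Rightarrow> real" and M :: real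
  assumes Q: "Q \<ge> 2" and \<beta>: "\<beta> > 1" and \<omega>: "\<omega> > 1" and eps: "\<epsilon>star > 0" and C3: "C3 > 0"
    and \<nu>: "\<nu> > 0" and K: "K \<ge> 2" and L: "L \<ge> 1"
    and inst: "(y, z, P) \<in> sbm_class Q \<beta> \<omega> \<epsilon>star C3 \<nu> n m K L Istar"
    and info_eq: "info_min K L (rates m z P) = Istar"
  defines "\<Lambda> \<equiv> rates m z P" and "M \<equiv> rate_max K L (rates m z P)"
begin

lemma z: "z \<in> {1..m} \<rightarrow> {1..L}"
  and P: "k \<in> {1..K} \<Longrightarrow> l \<in> {1..L} \<Longrightarrow> P (k, l) \<in> {0..1}"
  using inst by (auto simp: sbm_class_def)

lemma
  shows eps_min: "\<epsilon>star \<le> eps_min K L \<Lambda>"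
    and rate_min_pos: "rate_min K L \<Lambda> > 0"
    and block_prop: "l \<in> {1..L} \<Longrightarrow> 1 / (\<beta> * real L) \<le> label_prop m z l"
    and row_prop: "k \<in> {1..K} \<Longrightarrow> 1 / (\<beta> * real K) \<le> label_prop n y k"
    and size_condition: "((real Q)\<^sup>2 * ln (real Q)) * \<beta>\<^sup>2 * \<omega> ^ 3 * real K * real L * real (max K L)
      * ln (real (max K L)) * M\<^sup>2 \<le> C3 * real (min n m)"
    and signal_condition: "(real Q * ln (real Q))\<^sup>2 * \<beta> ^ 3 * \<omega>\<^sup>2 * real (max K L) ^ 3
      * max (real m / real n) (inverse (real m / real n)) * M \<le> \<nu> * Istar\<^sup>2"
  using inst info_eq by (simp_all add: sbm_class_def Let_def \<Lambda>_def M_def)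

lemma rate_ratio: "M \<le> \<omega> * rate_min K L \<Lambda>"
proof -
  have "M / rate_min K L \<Lambda> \<le> \<omega>"
    using inst by (simp add: sbm_class_def Let_def \<Lambda>_def M_def)
  then show ?thesis using rate_min_pos by (simp add: pos_divide_le_eq)
qed

lemma rate_bounds:
  assumes "k \<in> {1..K}" "l \<in> {1..L}"
  shows "rate_min K L \<Lambda> \<le> \<Lambda> k l" "\<Lambda> k l \<le> M" "0 < \<Lambda> k l"
proof -
  let ?S = "(\<lambda>(k, l). \<Lambda> k l) ` ({1..K} \<times> {1..L})"
  have "finite ?S" "\<Lambda> k l \<in> ?S" using assms by (auto intro!: image_eqI[of _ _ "(k, l)"])
  then show *: "rate_min K L \<Lambda> \<le> \<Lambda> k l" "\<Lambda> k l \<le> M"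
    by (simp_all only: rate_min_def rate_max_def M_def \<Lambda>_def[symmetric] Min_le Max_ge)
  show "0 < \<Lambda> k l" using * rate_min_pos by simp
qed

lemma M_pos: "M > 0"
  using rate_bounds[of 1 1] K L by auto

lemma size_pos: "n > 0" "m > 0"
proof -
  have "0 < 1 / (\<beta> * real K)" "0 < 1 / (\<beta> * real L)" using \<beta> K L by auto
  moreover have "1 / (\<beta> * real K) \<le> label_prop n y 1" "1 / (\<beta> * real L) \<le> label_prop m z 1"
    using row_prop[of 1] block_prop[of 1] K L by auto
  ultimately have "0 < label_prop n y 1" "0 < label_prop m z 1" by linarith+
  then show "n > 0" "m > 0" by (auto simp: label_prop_def intro: Nat.gr0I)
qed

lemma ln_ge_half:
  assumes "k \<ge> 2"
  shows "1 / 2 \<le> ln (real k)"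
proof -
  have "1 / 2 \<le> ln (2 :: real)" using ln2_ge_two_thirds by simp
  also have "\<dots> \<le> ln (real k)" using assms by (intro ln_mono) auto
  finally show ?thesis .
qed

text \<open>The remaining factors of the size condition are at least \<open>1\<close> and are discarded.\<close>

lemma size_bounds: "M\<^sup>2 * real K \<le> C3 * real n" "M\<^sup>2 * real L \<le> C3 * real m"
proof -
  let ?H = "real (max K L)"
  have q: "1 \<le> (real Q)\<^sup>2 * ln (real Q)"
  proof -
    have "2\<^sup>2 \<le> (real Q)\<^sup>2" using Q by (intro power_mono) auto
    then have "4 * (1 / 2) \<le> (real Q)\<^sup>2 * ln (real Q)"
      using ln_ge_half[OF Q] by (intro mult_mono) auto
    then show ?thesis by simp
  qed
  have h: "1 \<le> ?H * ln ?H"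
  proof -
    have "2 * (1 / 2) \<le> ?H * ln ?H"
      using K ln_ge_half[of "max K L"] by (intro mult_mono) auto
    then show ?thesis by simp
  qed
  have "1 \<le> ((real Q)\<^sup>2 * ln (real Q)) * \<beta>\<^sup>2 * \<omega> ^ 3 * (?H * ln ?H)"
    using \<beta> \<omega> by (intro mult_ge1_I one_le_power q h) auto
  then have "1 * (real K * real L * M\<^sup>2)
      \<le> (((real Q)\<^sup>2 * ln (real Q)) * \<beta>\<^sup>2 * \<omega> ^ 3 * (?H * ln ?H)) * (real K * real L * M\<^sup>2)"
    by (rule mult_right_mono) simp
  also have "\<dots> \<le> C3 * real (min n m)"
    using size_condition by (simp only: mult_ac)
  finally have *: "real K * real L * M\<^sup>2 \<le> C3 * real (min n m)" by simp
  have "real K * 1 * M\<^sup>2 \<le> real K * real L * M\<^sup>2" "1 * real L * M\<^sup>2 \<le> real K * real L * M\<^sup>2"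
    using K L by (intro mult_right_mono mult_left_mono; simp)+
  moreover have "C3 * real (min n m) \<le> C3 * real n" "C3 * real (min n m) \<le> C3 * real m"
    using C3 by auto
  ultimately show "M\<^sup>2 * real K \<le> C3 * real n" "M\<^sup>2 * real L \<le> C3 * real m"
    using * by (auto simp: mult_ac)
qed

lemma least_favourable_pair:
  obtains k r where "k \<in> {1..K}" "r \<in> {1..K}" "k \<noteq> r" "info L \<Lambda> k r = Istar"
proof -
  let ?S = "{info L \<Lambda> k r |k r. k \<in> {1..K} \<and> r \<in> {1..K} \<and> k \<noteq> r}"
  have "?S \<subseteq> (\<lambda>(k, r). info L \<Lambda> k r) ` ({1..K} \<times> {1..K})" by auto
  then have "finite ?S" by (rule finite_subset) auto
  moreover have "info L \<Lambda> 1 2 \<in> ?S"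
    using K by (intro CollectI exI[of _ 1] exI[of _ 2]) auto
  ultimately have "Istar \<in> ?S"
    unfolding info_eq[symmetric] info_min_def \<Lambda>_def[symmetric] by (intro Min_in) auto
  then show ?thesis using that by blast
qed

lemma Istar_le: "Istar \<le> real L * M"
proof -
  obtain k r where kr: "k \<in> {1..K}" "r \<in> {1..K}" "info L \<Lambda> k r = Istar"
    by (rule least_favourable_pair)
  have "info L \<Lambda> k r \<le> real L * M"
    using rate_bounds kr by (intro info_bounds) (auto intro: less_imp_le)
  then show ?thesis by (simp add: kr)
qed

text \<open>The converse order \<open>M = O(Istar)\<close>; it turns factors \<open>1 / M\<close> into factors \<open>1 / Istar\<close>.\<close>

lemma Istar_ge: "(sqrt (1 + \<epsilon>star) - 1)\<^sup>2 / 2 * M \<le> \<omega> * Istar"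
proof -
  obtain k r where kr: "k \<in> {1..K}" "r \<in> {1..K}" "k \<noteq> r" "info L \<Lambda> k r = Istar"
    by (rule least_favourable_pair)
  let ?S = "{eps_pair L \<Lambda> k r |k r. k \<in> {1..K} \<and> r \<in> {1..K} \<and> k \<noteq> r}"
  have "?S \<subseteq> (\<lambda>(k, r). eps_pair L \<Lambda> k r) ` ({1..K} \<times> {1..K})" by auto
  then have "finite ?S" by (rule finite_subset) auto
  moreover have "eps_pair L \<Lambda> k r \<in> ?S" using kr by blast
  ultimately have "eps_min K L \<Lambda> \<le> eps_pair L \<Lambda> k r"
    unfolding eps_min_def by (rule Min_le)
  then have "1 + \<epsilon>star \<le> Max ((\<lambda>l. max (\<Lambda> k l / \<Lambda> r l) (\<Lambda> r l / \<Lambda> k l)) ` {1..L})"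
    using eps_min by (simp add: eps_pair_def)
  moreover have "Max ((\<lambda>l. max (\<Lambda> k l / \<Lambda> r l) (\<Lambda> r l / \<Lambda> k l)) ` {1..L})
      \<in> (\<lambda>l. max (\<Lambda> k l / \<Lambda> r l) (\<Lambda> r l / \<Lambda> k l)) ` {1..L}"
    using L by (intro Max_in) auto
  ultimately obtain l where l: "l \<in> {1..L}" "1 + \<epsilon>star \<le> max (\<Lambda> k l / \<Lambda> r l) (\<Lambda> r l / \<Lambda> k l)"
    by auto
  have "(1 + \<epsilon>star) * \<Lambda> r l \<le> \<Lambda> k l \<or> (1 + \<epsilon>star) * \<Lambda> k l \<le> \<Lambda> r l"
    using l(2) rate_bounds(3)[OF kr(1) l(1)] rate_bounds(3)[OF kr(2) l(1)]
    by (simp add: le_max_iff_disj pos_le_divide_eq)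
  then have *: "(sqrt (1 + \<epsilon>star) - 1)\<^sup>2 / 2 * rate_min K L \<Lambda> \<le> info L \<Lambda> k r"
    using rate_bounds kr l(1) eps rate_min_pos by (intro info_ge_if_ratio[where M=M]) (auto intro: less_imp_le)
  have "(sqrt (1 + \<epsilon>star) - 1)\<^sup>2 / 2 * M \<le> (sqrt (1 + \<epsilon>star) - 1)\<^sup>2 / 2 * (\<omega> * rate_min K L \<Lambda>)"
    using rate_ratio by (intro mult_left_mono) auto
  also have "\<dots> = \<omega> * ((sqrt (1 + \<epsilon>star) - 1)\<^sup>2 / 2 * rate_min K L \<Lambda>)" by simp
  also have "\<dots> \<le> \<omega> * Istar" using * kr(4) \<omega> by (intro mult_left_mono) auto
  finally show ?thesis .
qed

lemma Istar_pos: "Istar > 0"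
proof -
  have "sqrt (1 + \<epsilon>star) > 1" using eps by simp
  then have "0 < (sqrt (1 + \<epsilon>star) - 1)\<^sup>2 / 2 * M" using M_pos by simp
  also have "\<dots> \<le> \<omega> * Istar" by (rule Istar_ge)
  finally show ?thesis using \<omega> by (simp add: zero_less_mult_iff)
qed

text \<open>
  With \<open>H = max K L\<close>, the signal condition gives \<open>H\<^sup>3 M \<le> \<nu> Istar\<^sup>2 \<le> \<nu> (H M)\<^sup>2\<close>, so
  \<open>H \<le> \<nu> M\<close>.
\<close>

lemma M_large: "1 / \<nu> \<le> M"
proof -
  let ?H = "real (max K L)"
  let ?a = "real m / real n"
  have H: "?H \<ge> 2" "?H \<ge> real L" using K by auto
  have q: "1 \<le> (real Q * ln (real Q))\<^sup>2"
  proof -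
    have "2 * (1 / 2) \<le> real Q * ln (real Q)"
      using Q ln_ge_half[OF Q] by (intro mult_mono) auto
    then show ?thesis by (intro one_le_power) simp
  qed
  have a: "1 \<le> max ?a (inverse ?a)"
  proof (cases "?a \<ge> 1")
    case False
    then show ?thesis using size_pos by (simp add: le_max_iff_disj field_simps)
  qed (simp add: le_max_iff_disj)
  have "1 \<le> (real Q * ln (real Q))\<^sup>2 * \<beta> ^ 3 * \<omega>\<^sup>2 * max ?a (inverse ?a)"
    using \<beta> \<omega> by (intro mult_ge1_I one_le_power q a) auto
  then have "1 * (?H ^ 3 * M)
      \<le> ((real Q * ln (real Q))\<^sup>2 * \<beta> ^ 3 * \<omega>\<^sup>2 * max ?a (inverse ?a)) * (?H ^ 3 * M)"
    using M_pos by (intro mult_right_mono) auto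
  also have "\<dots> \<le> \<nu> * Istar\<^sup>2"
    using signal_condition by (simp only: mult_ac)
  also have "\<dots> \<le> \<nu> * (?H * M)\<^sup>2"
  proof -
    have "Istar \<le> ?H * M"
      using Istar_le mult_right_mono[OF H(2), of M] M_pos by linarith
    then show ?thesis using \<nu> Istar_pos by (intro mult_left_mono power_mono) auto
  qed
  finally have "?H * (?H\<^sup>2 * M) \<le> (\<nu> * M) * (?H\<^sup>2 * M)"
    by (simp add: power_mult_distrib power2_eq_square power3_eq_cube mult_ac)
  moreover have "0 < ?H\<^sup>2 * M" using H(1) M_pos by (intro mult_pos_pos zero_less_power) linarith+
  ultimately have "?H \<le> \<nu> * M" by (simp only: mult_le_cancel_right_pos)
  then have "1 \<le> \<nu> * M" using H by simp
  then show ?thesis using \<nu> by (simp add: pos_divide_le_eq mult.commute)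
qed

text \<open>
  Balanced blocks have size at least \<open>m / (\<beta> L)\<close>, which the size condition compares with the
  squared rates. Hence entry probabilities are small, and \<open>C3 * \<beta>\<close> is the constant in the Poisson
  approximation.
\<close>

lemma block_size:
  assumes l: "l \<in> {1..L}"
  shows "label_count m z l > 0" "M\<^sup>2 \<le> C3 * \<beta> * real (label_count m z l)"
proof -
  show "label_count m z l > 0"
    using rate_bounds(3)[of 1 l] K l by (auto simp: \<Lambda>_def rates_def intro: Nat.gr0I)
  have "real m / (\<beta> * real L) \<le> real (label_count m z l)"
    using block_prop[OF l] size_pos by (simp add: label_prop_def pos_le_divide_eq)
  then have *: "real m \<le> real (label_count m z l) * (\<beta> * real L)"
    using \<beta> L by (subst (asm) pos_divide_le_eq) auto
  have "M\<^sup>2 * real L \<le> C3 * real m" by (rule size_bounds)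
  also have "\<dots> \<le> C3 * (real (label_count m z l) * (\<beta> * real L))"
    using * C3 by (intro mult_left_mono) auto
  finally have "M\<^sup>2 * real L \<le> (C3 * \<beta> * real (label_count m z l)) * real L"
    by (simp add: mult_ac)
  then show "M\<^sup>2 \<le> C3 * \<beta> * real (label_count m z l)"
    using L by (subst (asm) mult_le_cancel_right_pos) auto
qed

lemma row_likelihood_at_chernoff_point:
  assumes M: "\<omega> \<le> M" "2 * (C3 * \<beta>) \<le> M" and kr: "k \<in> {1..K}" "r \<in> {1..K}"
  obtains X where "\<And>k'. k' \<in> {k, r} \<Longrightarrow>
    exp (- info L \<Lambda> k r - real L * (ln M + ln \<omega> + 2 + 4 * (C3 * \<beta>)))
      \<le> (\<Prod>l=1..L. real (label_count m z l choose X l) *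
             (P (k', l) ^ X l * (1 - P (k', l)) ^ (label_count m z l - X l)))"
proof -
  have "1 \<le> rate_min K L \<Lambda>"
  proof -
    have "\<omega> * 1 \<le> \<omega> * rate_min K L \<Lambda>" using M(1) rate_ratio by simp
    then show ?thesis using \<omega> by (subst (asm) mult_le_cancel_left_pos) auto
  qed
  then have 1: "1 \<le> \<Lambda> k' l \<and> \<Lambda> k' l \<le> M" if "k' \<in> {k, r}" "l \<in> {1..L}" for k' l
    using rate_bounds[of k' l] that kr by auto
  have ln_le: "ln b - ln a \<le> ln \<omega>" if "rate_min K L \<Lambda> \<le> a" "b \<le> M" "0 < b" for a b
  proof -
    have "b \<le> \<omega> * a"
      using that rate_ratio \<omega> by (meson mult_left_mono order_trans less_imp_le zero_less_one order_less_trans)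
    moreover have "a > 0" using that rate_min_pos by simp
    ultimately have "ln b \<le> ln (\<omega> * a)" using that by (intro ln_mono) auto
    then show ?thesis using \<omega> \<open>a > 0\<close> by (simp add: ln_mult)
  qed
  have 2: "\<bar>ln (\<Lambda> r l) - ln (\<Lambda> k l)\<bar> \<le> ln \<omega>" if l: "l \<in> {1..L}" for l
    using ln_le[of "\<Lambda> r l" "\<Lambda> k l"] ln_le[of "\<Lambda> k l" "\<Lambda> r l"] rate_bounds[OF kr(1) l] rate_bounds[OF kr(2) l]
    by (auto simp: abs_le_iff)
  have 3: "label_count m z l > 0 \<and> M \<le> real (label_count m z l) / 2
      \<and> M\<^sup>2 \<le> (C3 * \<beta>) * real (label_count m z l)" if l: "l \<in> {1..L}" for l
  proof -
    have "(2 * (C3 * \<beta>)) * M \<le> M * M" using M M_pos by (intro mult_right_mono) auto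
    also have "\<dots> \<le> C3 * \<beta> * real (label_count m z l)"
      using block_size[OF l] by (simp add: power2_eq_square)
    finally have "(C3 * \<beta>) * (2 * M) \<le> (C3 * \<beta>) * real (label_count m z l)" by (simp add: mult_ac)
    then have "2 * M \<le> real (label_count m z l)"
      using C3 \<beta> by (subst (asm) mult_le_cancel_left_pos) auto
    then show ?thesis using block_size[OF l] by simp
  qed
  have ratio: "\<Lambda> k' l / real (label_count m z l) = P (k', l)" if "l \<in> {1..L}" for k' l
    using block_size(1)[OF that] by (simp add: \<Lambda>_def rates_def)
  obtain X where X: "\<And>k'. k' \<in> {k, r} \<Longrightarrow>
    exp (- info L \<Lambda> k r - real L * (ln M + ln \<omega> + 2 + 4 * (C3 * \<beta>)))
      \<le> (\<Prod>l=1..L. real (label_count m z l choose X l) *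
             ((\<Lambda> k' l / real (label_count m z l)) ^ X l
               * (1 - \<Lambda> k' l / real (label_count m z l)) ^ (label_count m z l - X l)))"
    using block_binomials_at_chernoff_point[where k=k and r=r and L=L and \<Lambda>=\<Lambda> and M=M
        and \<rho>="ln \<omega>" and N="label_count m z" and D="C3 * \<beta>", OF 1 2 3] by blast
  show ?thesis
  proof (rule that)
    fix k' assume k': "k' \<in> {k, r}"
    show "exp (- info L \<Lambda> k r - real L * (ln M + ln \<omega> + 2 + 4 * (C3 * \<beta>)))
      \<le> (\<Prod>l=1..L. real (label_count m z l choose X l) *
             (P (k', l) ^ X l * (1 - P (k', l)) ^ (label_count m z l - X l)))"
    proof (rule order_trans[OF X[OF k']], rule eq_refl, rule prod.cong[OF refl])
      fix l assume "l \<in> {1..L}"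
      then show "real (label_count m z l choose X l) *
             ((\<Lambda> k' l / real (label_count m z l)) ^ X l
               * (1 - \<Lambda> k' l / real (label_count m z l)) ^ (label_count m z l - X l))
          = real (label_count m z l choose X l) *
             (P (k', l) ^ X l * (1 - P (k', l)) ^ (label_count m z l - X l))"
        by (simp only: ratio)
    qed
  qed
qed

lemma change_row_labels:
  assumes "y' \<in> {1..n} \<rightarrow>\<^sub>E {1..K}"
    and "\<And>k. k \<in> {1..K} \<Longrightarrow> 1 / (\<beta> * real K) \<le> label_prop n y' k \<and> label_prop n y' k \<le> \<beta> / real K"
  shows "(y', z, P) \<in> sbm_class Q \<beta> \<omega> \<epsilon>star C3 \<nu> n m K L Istar"
  using inst assms by (auto simp: sbm_class_def Let_def)

section \<open>The risk of an estimator\<close>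

text \<open>
  The number \<open>\<delta>\<close> is such that clusters of size \<open>c0 = n / K\<close> can gain or lose \<open>2 \<delta> c0\<close> rows: losing
  them leaves exactly \<open>c0 / \<beta>\<close>, and gaining them stays below \<open>\<beta> c0\<close> since
  \<open>1 - 1 / \<beta> \<le> \<beta> - 1\<close>. Half of this room is used for the rows in \<open>T\<close>, the other half for the rounding
  error of at most one row in the cyclic labelling.
\<close>

lemma risk_lower_bound:
  assumes M: "\<omega> \<le> M" "2 * (C3 * \<beta>) \<le> M"
    and n_large: "\<beta> \<le> real n / real K" "2 \<le> \<delta> * (real n / real K)"
    and \<delta>: "\<delta> = (1 - 1 / \<beta>) / 2"
  shows "\<exists>y'. (y', z, P) \<in> sbm_class Q \<beta> \<omega> \<epsilon>star C3 \<nu> n m K L Istar \<and>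
           \<delta> / (8 * real K) * exp (- Istar - real L * (ln M + ln \<omega> + 2 + 4 * (C3 * \<beta>)))
             \<le> measure_pmf.expectation (SBM n m y' z P) (\<lambda>A. Mis n K (yhat A) y')"
proof -
  define B where "B = exp (- Istar - real L * (ln M + ln \<omega> + 2 + 4 * (C3 * \<beta>)))"
  define y0 where "y0 = cyclic_labels n K"
  define c0 where "c0 = real n / real K"
  define t where "t = nat \<lfloor>\<delta> * c0\<rfloor>"
  obtain k r where kr: "k \<in> {1..K}" "r \<in> {1..K}" "k \<noteq> r" "info L \<Lambda> k r = Istar"
    by (rule least_favourable_pair)
  have \<delta>0: "0 < \<delta>" using \<beta> by (simp add: \<delta>)
  have t: "real t \<le> \<delta> * c0" "\<delta> * c0 / 2 \<le> real t"
    using n_large unfolding t_def c0_def[symmetric] by linarith+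
  have count: "c0 - 1 \<le> real (label_count n y0 a)" "real (label_count n y0 a) \<le> c0 + 1"
    if "a \<in> {1..K}" for a
  proof -
    have "\<lfloor>c0\<rfloor> = int (n div K)" unfolding c0_def by (rule floor_divide_of_nat_eq)
    then have "real (n div K) \<le> c0" "c0 - 1 \<le> real (n div K)" by linarith+
    moreover have "real (n div K) \<le> real (label_count n y0 a)" "real (label_count n y0 a) \<le> real (n div K) + 1"
      using label_count_cyclic_labels[OF that, of n] unfolding y0_def by linarith+
    ultimately show "c0 - 1 \<le> real (label_count n y0 a)" "real (label_count n y0 a) \<le> c0 + 1"
      by linarith+
  qed
  have room: "2 * (\<delta> * c0) = c0 - c0 / \<beta>" by (simp add: \<delta> field_simps)
  have c\<beta>: "1 \<le> c0 / \<beta>" using n_large(1) \<beta> unfolding c0_def[symmetric] by (simp add: pos_le_divide_eq)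
  have "t \<le> label_count n y0 k"
  proof -
    have "real t \<le> c0 - 1" using t(1) room c\<beta> n_large(2) by (simp add: c0_def)
    also have "\<dots> \<le> real (label_count n y0 k)" by (rule count) fact
    finally show ?thesis by simp
  qed
  then obtain T where T: "T \<subseteq> {i \<in> {1..n}. y0 i = k}" "card T = t" "finite T"
    unfolding label_count_def by (rule obtain_subset_with_card_n)
  have Tn: "T \<subseteq> {1..n}" using T by auto
  \<comment> \<open>The vertices of the cube: the rows in \<open>U \<subseteq> T\<close> move from cluster \<open>k\<close> to cluster \<open>r\<close>.\<close>
  define yU where "yU = (\<lambda>U i. if i \<in> U then r else y0 i)"
  have in_class: "(yU U, z, P) \<in> sbm_class Q \<beta> \<omega> \<epsilon>star C3 \<nu> n m K L Istar" if U: "U \<subseteq> T" for U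
  proof (rule change_row_labels)
    show "yU U \<in> {1..n} \<rightarrow>\<^sub>E {1..K}"
      using U Tn kr K by (auto simp: yU_def y0_def cyclic_labels_def PiE_iff extensional_def Suc_le_eq)
    fix a assume a: "a \<in> {1..K}"
    have "card {i \<in> {1..n}. yU U i = a} \<le> card ({i \<in> {1..n}. y0 i = a} \<union> T)"
      using U \<open>finite T\<close> by (intro card_mono) (auto simp: yU_def)
    also have "\<dots> \<le> label_count n y0 a + t"
      unfolding label_count_def T(2)[symmetric] by (rule card_Un_le)
    finally have up: "real (label_count n (yU U) a) \<le> c0 + 1 + \<delta> * c0"
      using count(2)[OF a] t(1) by (simp add: label_count_def)
    have "card {i \<in> {1..n}. y0 i = a} \<le> card ({i \<in> {1..n}. yU U i = a} \<union> T)"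
      using U \<open>finite T\<close> by (intro card_mono) (auto simp: yU_def)
    also have "\<dots> \<le> label_count n (yU U) a + t"
      unfolding label_count_def T(2)[symmetric] by (rule card_Un_le)
    finally have lo: "c0 - 1 - \<delta> * c0 \<le> real (label_count n (yU U) a)"
      using count(1)[OF a] t(1) by (simp add: label_count_def)
    have "c0 / \<beta> \<le> real (label_count n (yU U) a)"
      using lo room n_large(2) by (simp add: c0_def)
    moreover have "real (label_count n (yU U) a) \<le> c0 * \<beta>"
    proof -
      have "1 - 1 / \<beta> \<le> \<beta> - 1"
      proof -
        have "0 \<le> (\<beta> - 1)\<^sup>2 / \<beta>" using \<beta> by simp
        also have "\<dots> = \<beta> - 2 + 1 / \<beta>" using \<beta> by (simp add: field_simps power2_eq_square)
        finally show ?thesis by simp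
      qed
      then have "c0 * (1 - 1 / \<beta>) \<le> c0 * (\<beta> - 1)"
        by (intro mult_left_mono) (auto simp: c0_def)
      then have "c0 + 2 * (\<delta> * c0) \<le> c0 * \<beta>" unfolding room by (simp add: algebra_simps)
      then show ?thesis using up n_large(2) by (simp add: c0_def)
    qed
    ultimately show "1 / (\<beta> * real K) \<le> label_prop n (yU U) a \<and> label_prop n (yU U) a \<le> \<beta> / real K"
      using size_pos(1) K \<beta> by (simp add: label_prop_def c0_def field_simps)
  qed
  have "\<exists>U\<subseteq>T. 1 / real n * real (card T) * B / 4
      \<le> measure_pmf.expectation (SBM n m (yU U) z P) (\<lambda>A. Mis n K (yhat A) (yU U))"
  proof (rule Assouad)
    show "finite T" by fact
    show "finite (set_pmf (SBM n m (yU U) z P))" for U by (rule finite_set_SBM)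
    show "0 \<le> 1 / real n" by simp
    fix A U V assume U: "U \<subseteq> T" and V: "V \<subseteq> T"
    have "{i \<in> {1..n}. yU U i \<noteq> yU V i} = {i \<in> T. (i \<in> U) \<noteq> (i \<in> V)}"
    proof -
      have "yU U i \<noteq> yU V i \<longleftrightarrow> (i \<in> U) \<noteq> (i \<in> V)" if "i \<in> T" for i
        using that T(1) kr(3) by (auto simp: yU_def)
      moreover have "yU U i = yU V i" if "i \<notin> T" for i
        using that U V by (auto simp: yU_def)
      ultimately show ?thesis using Tn by blast
    qed
    moreover have "real (card {i \<in> {1..n}. yU U i \<noteq> yU V i}) / real n
        \<le> Mis n K (yhat A) (yU U) + Mis n K (yhat A) (yU V)"
    proof (rule Mis_separation[OF size_pos(1) Tn])
      show "yU U i = y0 i" "yU V i = y0 i" if "i \<in> {1..n} - T" for i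
        using that U V by (auto simp: yU_def)
      fix a assume a: "a \<in> {1..K}"
      have "label_count n y0 a \<le> card ({i \<in> {1..n} - T. y0 i = a} \<union> T)"
        unfolding label_count_def using \<open>finite T\<close> by (intro card_mono) auto
      also have "\<dots> \<le> card {i \<in> {1..n} - T. y0 i = a} + t"
        unfolding T(2)[symmetric] by (rule card_Un_le)
      finally have "c0 - 1 - \<delta> * c0 \<le> real (card {i \<in> {1..n} - T. y0 i = a})"
        using count(1)[OF a] t(1) by linarith
      then have "real t \<le> real (card {i \<in> {1..n} - T. y0 i = a})"
        using t(1) room c\<beta> by linarith
      then show "card T \<le> card {i \<in> {1..n} - T. y0 i = a}" using T(2) by simp
    qed
    ultimately show "1 / real n * real (card {i \<in> T. (i \<in> U) \<noteq> (i \<in> V)})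
        \<le> Mis n K (yhat A) (yU U) + Mis n K (yhat A) (yU V)" by simp
  next
    fix i U D assume i: "i \<in> T" and U: "U \<subseteq> T - {i}"
    obtain X where X: "\<And>k'. k' \<in> {k, r} \<Longrightarrow>
      exp (- info L \<Lambda> k r - real L * (ln M + ln \<omega> + 2 + 4 * (C3 * \<beta>)))
        \<le> (\<Prod>l=1..L. real (label_count m z l choose X l) *
               (P (k', l) ^ X l * (1 - P (k', l)) ^ (label_count m z l - X l)))"
      using row_likelihood_at_chernoff_point[OF M kr(1,2)] by blast
    have i_labels: "yU U i = k" "yU (insert i U) i = r"
      using i U T(1) by (auto simp: yU_def)
    show "B \<le> measure_pmf.prob (SBM n m (yU U) z P) D
             + measure_pmf.prob (SBM n m (yU (insert i U)) z P) (- D)"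
    proof (rule SBM_testing_errors[OF _ _ z])
      show "i \<in> {1..n}" using i Tn by auto
      show "yU U i' = yU (insert i U) i'" if "i' \<in> {1..n} - {i}" for i'
        using that by (auto simp: yU_def)
      show "P (yU U i, l) \<in> {0..1}" "P (yU (insert i U) i, l) \<in> {0..1}" if "l \<in> {1..L}" for l
        unfolding i_labels by (intro P kr that)+
      show "B \<le> (\<Prod>l=1..L. real (label_count m z l choose X l) *
               (P (k', l) ^ X l * (1 - P (k', l)) ^ (label_count m z l - X l)))"
        if "k' \<in> {yU U i, yU (insert i U) i}" for k'
        using X[of k'] that unfolding i_labels B_def kr(4) by blast
    qed
  qed
  then obtain U where U: "U \<subseteq> T" "1 / real n * real (card T) * B / 4
      \<le> measure_pmf.expectation (SBM n m (yU U) z P) (\<lambda>A. Mis n K (yhat A) (yU U))" by blast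
  have "\<delta> / (8 * real K) * B \<le> 1 / real n * real (card T) * B / 4"
  proof -
    have "\<delta> / (8 * real K) = 1 / real n * (\<delta> * c0 / 2) / 4"
      using size_pos(1) K by (simp add: c0_def)
    also have "\<dots> \<le> 1 / real n * real (card T) / 4"
      using t(2) T(2) by (intro divide_right_mono mult_left_mono) auto
    finally have "\<delta> / (8 * real K) * B \<le> 1 / real n * real (card T) / 4 * B"
      by (rule mult_right_mono) (simp add: B_def)
    then show ?thesis by simp
  qed
  then have "\<delta> / (8 * real K) * B
      \<le> measure_pmf.expectation (SBM n m (yU U) z P) (\<lambda>A. Mis n K (yhat A) (yU U))"
    using U(2) by linarith
  then show ?thesis using in_class[OF U(1)] unfolding B_def by blast
qed

lemma minimax_risk_lower_bound:
  assumes "\<omega> \<le> M" "2 * (C3 * \<beta>) \<le> M"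
    and "\<beta> \<le> real n / real K" "2 \<le> \<delta> * (real n / real K)"
    and "\<delta> = (1 - 1 / \<beta>) / 2"
  shows "\<delta> / (8 * real K) * exp (- Istar - real L * (ln M + ln \<omega> + 2 + 4 * (C3 * \<beta>)))
    \<le> (INF yhat \<in> estimators n K.
         SUP (y, z, P) \<in> sbm_class Q \<beta> \<omega> \<epsilon>star C3 \<nu> n m K L Istar.
           measure_pmf.expectation (SBM n m y z P) (\<lambda>A. Mis n K (yhat A) y))"
proof (rule cINF_greatest)
  have "(\<lambda>_. \<lambda>i\<in>{1..n}. 1) \<in> estimators n K" using K by (auto simp: estimators_def)
  then show "estimators n K \<noteq> {}" by blast
  fix yhat :: "(nat \<times> nat \<Rightarrow> bool) \<Rightarrow> nat \<Rightarrow> nat"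
  let ?R = "\<lambda>(y, z, P). measure_pmf.expectation (SBM n m y z P) (\<lambda>A. Mis n K (yhat A) y)"
  obtain y' where y': "(y', z, P) \<in> sbm_class Q \<beta> \<omega> \<epsilon>star C3 \<nu> n m K L Istar"
    "\<delta> / (8 * real K) * exp (- Istar - real L * (ln M + ln \<omega> + 2 + 4 * (C3 * \<beta>))) \<le> ?R (y', z, P)"
    using risk_lower_bound[OF assms] by auto
  note y'(2)
  also have "?R (y', z, P) \<le> (SUP x \<in> sbm_class Q \<beta> \<omega> \<epsilon>star C3 \<nu> n m K L Istar. ?R x)"
  proof (rule cSUP_upper[OF y'(1)], rule bdd_aboveI2)
    fix x show "?R x \<le> 1"
    proof (cases x)
      case (fields y z P)
      have "measure_pmf.expectation (SBM n m y z P) (\<lambda>A. Mis n K (yhat A) y)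
          \<le> measure_pmf.expectation (SBM n m y z P) (\<lambda>A. 1)"
        by (intro integral_mono integrable_measure_pmf_finite finite_set_SBM Mis_bounds)
      then show ?thesis using fields by simp
    qed
  qed
  finally show "\<delta> / (8 * real K) * exp (- Istar - real L * (ln M + ln \<omega> + 2 + 4 * (C3 * \<beta>)))
      \<le> (SUP x \<in> sbm_class Q \<beta> \<omega> \<epsilon>star C3 \<nu> n m K L Istar. ?R x)" .
qed

end

theorem theorem2:
  fixes Q :: nat and \<beta> \<omega> \<epsilon>star C3 c :: real and \<nu> :: "nat \<Rightarrow> real"
    and m K L :: "nat \<Rightarrow> nat" and Istar :: "nat \<Rightarrow> real"
  assumes "Q \<ge> 2" and "\<beta> > 1" and "\<omega> > 1" and "\<epsilon>star > 0" and "C3 > 0" and "c > 0"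
    and "\<And>n. \<nu> n > 0" and "\<nu> \<longlonglongrightarrow> 0"
    and "\<forall>\<^sub>F n in sequentially. K n \<ge> 2 \<and> L n \<ge> 1"
    and "\<forall>\<^sub>F n in sequentially.
           \<exists>(y, z, P) \<in> sbm_class Q \<beta> \<omega> \<epsilon>star C3 (\<nu> n) n (m n) (K n) (L n) (Istar n).
             info_min (K n) (L n) (rates (m n) z P) = Istar n"
    and "\<forall>\<^sub>F n in sequentially. real (K n) \<le> exp (c * real (L n))"
  shows "\<exists>C::real. \<forall>\<^sub>F n in sequentially.
           (INF yhat \<in> estimators n (K n).
              SUP (y, z, P) \<in> sbm_class Q \<beta> \<omega> \<epsilon>star C3 (\<nu> n) n (m n) (K n) (L n) (Istar n).
                measure_pmf.expectation (SBM n (m n) y z P) (\<lambda>A. Mis n (K n) (yhat A) y))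
           \<ge> exp (- Istar n - real (L n) * (ln (Istar n) + C))"
proof -
  define \<delta> where "\<delta> = (1 - 1 / \<beta>) / 2"
  define D where "D = C3 * \<beta>"
  define \<kappa> where "\<kappa> = (sqrt (1 + \<epsilon>star) - 1)\<^sup>2 / 2"
  \<comment> \<open>The terms pay, in this order, for the factor \<open>\<delta> / 8\<close> from Assouad's lemma, the factor \<open>1 / K\<close>, the
    passage from \<open>ln M\<close> to \<open>ln Istar\<close>, and the rounding, Stirling and Poisson losses.\<close>
  define C where "C = ln (8 / \<delta>) + c + ln (\<omega> / \<kappa>) + ln \<omega> + 2 + 4 * D"
  \<comment> \<open>Once the largest rate is at least \<open>R\<close>, the conditions of \<open>minimax_risk_lower_bound\<close> hold.\<close>
  define R where "R = Max {\<omega>, 2 * D, D, 2 * C3 / \<delta>}"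
  have \<delta>: "0 < \<delta>" "\<delta> < 1"
    unfolding \<delta>_def using \<open>\<beta> > 1\<close> by (simp_all add: field_simps)
  have "sqrt (1 + \<epsilon>star) > 1" using \<open>\<epsilon>star > 0\<close> by simp
  then have \<kappa>: "\<kappa> > 0" by (simp add: \<kappa>_def)
  have R: "\<omega> \<le> R" "2 * D \<le> R" "D \<le> R" "2 * C3 / \<delta> \<le> R" by (auto simp: R_def)
  then have "R > 0" using \<open>\<omega> > 1\<close> by simp
  then have "\<forall>\<^sub>F n in sequentially. \<nu> n < 1 / R"
    using \<open>\<nu> \<longlonglongrightarrow> 0\<close> by (intro order_tendstoD) auto
  then have "\<forall>\<^sub>F n in sequentially.
      exp (- Istar n - real (L n) * (ln (Istar n) + C)) \<le>
      (INF yhat \<in> estimators n (K n).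
         SUP (y, z, P) \<in> sbm_class Q \<beta> \<omega> \<epsilon>star C3 (\<nu> n) n (m n) (K n) (L n) (Istar n).
           measure_pmf.expectation (SBM n (m n) y z P) (\<lambda>A. Mis n (K n) (yhat A) y))"
    using assms(9-11)
  proof eventually_elim
    case (elim n)
    then obtain y z P where inst:
      "(y, z, P) \<in> sbm_class Q \<beta> \<omega> \<epsilon>star C3 (\<nu> n) n (m n) (K n) (L n) (Istar n)"
      "info_min (K n) (L n) (rates (m n) z P) = Istar n" by blast
    interpret sbm_instance Q \<beta> \<omega> \<epsilon>star C3 "\<nu> n" n "m n" "K n" "L n" "Istar n" y z P
      "rates (m n) z P" "rate_max (K n) (L n) (rates (m n) z P)"
      using assms elim inst by unfold_locales auto
    define M where "M = rate_max (K n) (L n) (rates (m n) z P)"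
    have "R \<le> 1 / \<nu> n" using elim(1) \<open>R > 0\<close> \<open>\<nu> n > 0\<close> by (simp add: field_simps)
    also have "\<dots> \<le> M" unfolding M_def by (rule M_large)
    finally have MR: "R \<le> M" .
    have M1: "M \<ge> 1" using MR R(1) \<open>\<omega> > 1\<close> by simp
    have "M / C3 \<le> real n / real (K n)"
    proof -
      have "M * real (K n) \<le> M\<^sup>2 * real (K n)"
        using M1 by (intro mult_right_mono) (auto simp: power2_eq_square)
      also have "\<dots> \<le> C3 * real n" unfolding M_def by (rule size_bounds)
      finally show ?thesis using \<open>C3 > 0\<close> elim(2) by (simp add: field_simps)
    qed
    moreover have "\<beta> \<le> M / C3" "2 \<le> \<delta> * (M / C3)"
      using order_trans[OF R(3) MR] order_trans[OF R(4) MR] \<open>C3 > 0\<close> \<delta>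
      by (simp_all add: D_def field_simps)
    ultimately have c0: "\<beta> \<le> real n / real (K n)" "2 \<le> \<delta> * (real n / real (K n))"
      using mult_left_mono[of "M / C3" "real n / real (K n)" \<delta>] \<delta> by linarith+
    have "ln M \<le> ln (Istar n) + ln (\<omega> / \<kappa>)"
    proof -
      have "M \<le> \<omega> / \<kappa> * Istar n"
        using Istar_ge \<kappa> by (simp add: M_def \<kappa>_def[symmetric] field_simps)
      then have "ln M \<le> ln (\<omega> / \<kappa> * Istar n)" using M1 by (intro ln_mono) auto
      also have "\<dots> = ln (\<omega> / \<kappa>) + ln (Istar n)"
        using Istar_pos \<kappa> \<open>\<omega> > 1\<close> by (intro ln_mult_pos) auto
      finally show ?thesis by simp
    qed
    then have "real (L n) * (ln M + ln \<omega> + 2 + 4 * D + ln (8 / \<delta>) + c) \<le> real (L n) * (ln (Istar n) + C)"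
      unfolding C_def by (intro mult_left_mono) auto
    moreover have "1 * ln (8 / \<delta>) \<le> real (L n) * ln (8 / \<delta>)"
      using elim(2) \<delta> by (intro mult_right_mono) auto
    ultimately have "exp (- Istar n - real (L n) * (ln (Istar n) + C))
        \<le> exp (- ln (8 / \<delta>) + (- (c * real (L n)) + (- Istar n - real (L n) * (ln M + ln \<omega> + 2 + 4 * D))))"
      by (simp add: algebra_simps)
    also have "\<dots> = \<delta> / 8 * (exp (- (c * real (L n))) * exp (- Istar n - real (L n) * (ln M + ln \<omega> + 2 + 4 * D)))"
      unfolding exp_add using \<delta> by (simp add: exp_minus)
    also have "\<dots> \<le> \<delta> / 8 * (1 / real (K n) * exp (- Istar n - real (L n) * (ln M + ln \<omega> + 2 + 4 * D)))"
    proof (intro mult_left_mono mult_right_mono)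
      have "inverse (exp (c * real (L n))) \<le> inverse (real (K n))"
        using elim(2,4) by (intro le_imp_inverse_le) auto
      then show "exp (- (c * real (L n))) \<le> 1 / real (K n)"
        by (simp add: exp_minus inverse_eq_divide)
    qed (use \<delta> in auto)
    also have "\<dots> = \<delta> / (8 * real (K n)) * exp (- Istar n - real (L n) * (ln M + ln \<omega> + 2 + 4 * (C3 * \<beta>)))"
      by (simp add: D_def)
    also have "\<dots> \<le> (INF yhat \<in> estimators n (K n).
         SUP (y, z, P) \<in> sbm_class Q \<beta> \<omega> \<epsilon>star C3 (\<nu> n) n (m n) (K n) (L n) (Istar n).
           measure_pmf.expectation (SBM n (m n) y z P) (\<lambda>A. Mis n (K n) (yhat A) y))"
      unfolding M_def
    proof (rule minimax_risk_lower_bound[OF _ _ c0 \<delta>_def])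
      show "\<omega> \<le> rate_max (K n) (L n) (rates (m n) z P)"
        "2 * (C3 * \<beta>) \<le> rate_max (K n) (L n) (rates (m n) z P)"
        using MR R(1,2) unfolding M_def D_def by linarith+
    qed
    finally show ?case .
  qed
  then show ?thesis by blast
qed

end
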